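(* Let $1<p<n$, $\theta>1$, $\sigma>0$ with $0\le\frac1\theta-\frac1\sigma\le\frac1n$, $\frac1{p^*}=\frac1p-\frac1n$, $q=1+\frac{n-p}{p}\frac{\theta}{\theta-1}$, and $R>0$. Let $S$ be the best constant in the Caffarelli--Kohn--Nirenberg inequality on $\mathbb{R}^n$ recalled in the context. Then $$ S\left(\int_{B_R}\frac{|x|^{\frac{n\sigma}{p^*}}|u(x)|^\sigma}{\left[(q-1)\log_q\frac{R}{|x|}\right]^{1+\frac{\theta-1}{\theta}\sigma}}\frac{dx}{|x|^n}\right)^{\frac1\sigma}\le\left(\int_{B_R}|x|^{\frac{n\theta}{p}}|L_{p,\theta}u|^\theta\frac{dx}{|x|^n}\right)^{\frac1\theta}\qquad(\mathrm{A}) $$ for all $u\in C_0^\infty(B_R)$. If in addition $\theta=\sigma$, then, with $\tilde S$ the best constant in the radial-derivative inequality on $\mathbb{R}^n$ recalled in the context, $$ \tilde S\int_{B_R}\frac{|x|^{\frac{n\theta}{p^*}}|u(x)|^\theta}{\left[(q-1)\log_q\frac{R}{|x|}\right]^{\theta}}\frac{dx}{|x|^n}\le\int_{B_R}|x|^{\frac{n\theta}{p}}|\nabla_ru|^\theta\frac{dx}{|x|^n}\qquad(\mathrm{B}) $$ for all $u\in C_0^\infty(B_R)$. Moreover, the constants $S$ in (A) and $\tilde S$ in (B) are optimal (they cannot be replaced by larger ones), and (A) and (B) are invariant under the scaling, for $\lambda>0$, $$ u_\lambda(x):=\lambda^{-\frac{\theta-1}{\theta}}u(x_\lambda),\qquad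 x_\lambda:=\left[\lambda|x|^{-\frac{n-p}{p}\frac{\theta}{\theta-1}}+(1-\lambda)R^{-\frac{n-p}{p}\frac{\theta}{\theta-1}}\right]^{-\frac{p}{n-p}\frac{\theta-1}{\theta}}\frac{x}{|x|}, $$ that is, for every $u\in C_0^\infty(B_R)$ and $\lambda>0$, each side of (A) (and, when $\theta=\sigma$, each side of (B)) takes the same value for $u_\lambda$ as for $u$.
   Context: $B_R$ is the open ball in $\mathbb{R}^n$ centered at the origin with radius $R>0$; $C_0^\infty$ denotes smooth compactly supported functions. For $q>0$, $q\ne1$ and $r>0$, the $q$-logarithm is $\log_q r:=\frac{r^{1-q}-1}{1-q}$. For $x\ne0$ the radial and tangential derivatives are $$\nabla_ru(x):=\left(\frac{x}{|x|}\cdot\nabla u(x)\right)\frac{x}{|x|},\qquad \nabla_{\mathbb{S}^{n-1}}u(x):=\nabla u(x)-\nabla_ru(x),$$ and, with $q=1+\frac{n-p}{p}\frac{\theta}{\theta-1}$, $$L_{p,\theta}u(x):=\frac{\nabla_{\mathbb{S}^{n-1}}u(x)}{(q-1)\log_q\frac{R}{|x|}}+\nabla_ru(x).$$ Caffarelli--Kohn--Nirenberg inequality (known): under the stated conditions on $p,\theta,\sigma$, there is a positive constant such that $$S\left(\int_{\mathbb{R}^n}|x|^{\frac{n\sigma}{p^*}}|u(x)|^\sigma\frac{dx}{|x|^n}\right)^{\frac1\sigma}\le\left(\int_{\mathbb{R}^n}|x|^{\frac{n\theta}{p}}|\nabla u(x)|^\theta\frac{dx}{|x|^n}\right)^{\frac1\theta}\quad\text{for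 all }u\in C_0^\infty(\mathbb{R}^n);$$ $S$ denotes the best (largest) such constant. When $\theta=\sigma$, it is also known that there is a positive constant such that $$\tilde S\int_{\mathbb{R}^n}|x|^{\frac{n\theta}{p^*}}|u(x)|^\theta\frac{dx}{|x|^n}\le\int_{\mathbb{R}^n}|x|^{\frac{n\theta}{p}}|\nabla_ru(x)|^\theta\frac{dx}{|x|^n}\quad\text{for all }u\in C_0^\infty(\mathbb{R}^n);$$ $\tilde S$ denotes the best (largest) such constant. *)

theory Defs
  imports "HOL-Analysis.Analysis"
begin

definition grad :: "(real^'n \<Rightarrow> real) \<Rightarrow> real^'n \<Rightarrow> real^'n" where
  "grad u x = (THE D. GDERIV u x :> D)"

primrec C_k :: "nat \<Rightarrow> (real^'n \<Rightarrow> real) \<Rightarrow> bool" where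
  "C_k 0 u \<longleftrightarrow> continuous_on UNIV u"
| "C_k (Suc k) u \<longleftrightarrow> (\<forall>x. u differentiable (at x)) \<and> (\<forall>i. C_k k (\<lambda>x. grad u x $ i))"

text \<open>The space \<open>C\<^sub>0\<^sup>\<infinity>(\<Omega>)\<close> for open \<open>\<Omega>\<close>; its elements are
  extended by zero to the whole space.\<close>

definition C0_inf :: "(real^'n) set \<Rightarrow> (real^'n \<Rightarrow> real) set" where
  "C0_inf \<Omega> = {u. (\<forall>k. C_k k u) \<and> compact (closure (support_on UNIV u))
                   \<and> closure (support_on UNIV u) \<subseteq> \<Omega>}"

definition q_log :: "real \<Rightarrow> real \<Rightarrow> real" where
  "q_log q r = (r powr (1 - q) - 1) / (1 - q)"

text \<open>At the origin, where these fields are not defined on paper, the totalised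
  division makes the radial part zero; the origin is a null set.\<close>

definition grad_r :: "(real^'n \<Rightarrow> real) \<Rightarrow> real^'n \<Rightarrow> real^'n" where
  "grad_r u x = ((x /\<^sub>R norm x) \<bullet> grad u x) *\<^sub>R (x /\<^sub>R norm x)"

definition grad_S :: "(real^'n \<Rightarrow> real) \<Rightarrow> real^'n \<Rightarrow> real^'n" where
  "grad_S u x = grad u x - grad_r u x"

definition L_op :: "real \<Rightarrow> real \<Rightarrow> (real^'n \<Rightarrow> real) \<Rightarrow> real^'n \<Rightarrow> real^'n" where
  "L_op q R u x = grad_S u x /\<^sub>R ((q - 1) * q_log q (R / norm x)) + grad_r u x"

definition fun_integrand :: "real \<Rightarrow> real \<Rightarrow> (real^'n \<Rightarrow> real) \<Rightarrow> real^'n \<Rightarrow> real" where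
  "fun_integrand pstar \<sigma> u x =
     norm x powr (real CARD('n) * \<sigma> / pstar) * \<bar>u x\<bar> powr \<sigma> / norm x ^ CARD('n)"

definition field_integrand :: "real \<Rightarrow> real \<Rightarrow> (real^'n \<Rightarrow> real^'n) \<Rightarrow> real^'n \<Rightarrow> real" where
  "field_integrand p \<theta> V x =
     norm x powr (real CARD('n) * \<theta> / p) * norm (V x) powr \<theta> / norm x ^ CARD('n)"

definition log_integrand ::
  "real \<Rightarrow> real \<Rightarrow> real \<Rightarrow> real \<Rightarrow> real \<Rightarrow> (real^'n \<Rightarrow> real) \<Rightarrow> real^'n \<Rightarrow> real" where
  "log_integrand pstar q R \<sigma> e u x =
     norm x powr (real CARD('n) * \<sigma> / pstar) * \<bar>u x\<bar> powr \<sigma>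
       / ((q - 1) * q_log q (R / norm x)) powr e / norm x ^ CARD('n)"

text \<open>The largest constant \<open>C\<close> with \<open>C * F u \<le> G u\<close> for all \<open>u \<in> X\<close>. For nonnegative \<open>F\<close>, \<open>G\<close>
  with \<open>F\<close> not identically zero on \<open>X\<close>, the set below contains \<open>0\<close>, is closed and bounded
  above, so the supremum is attained; when the inequality holds with some positive constant,
  it is the largest positive constant.\<close>

definition best_constant :: "'a set \<Rightarrow> ('a \<Rightarrow> real) \<Rightarrow> ('a \<Rightarrow> real) \<Rightarrow> real" where
  "best_constant X F G = Sup {C. \<forall>u\<in>X. C * F u \<le> G u}"

definition CKN_lhs :: "real \<Rightarrow> real \<Rightarrow> (real^'n \<Rightarrow> real) \<Rightarrow> real" where
  "CKN_lhs pstar \<sigma> u = (\<integral>x. fun_integrand pstar \<sigma> u x \<partial>lborel) powr (1 / \<sigma>)"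

definition CKN_rhs :: "real \<Rightarrow> real \<Rightarrow> (real^'n \<Rightarrow> real) \<Rightarrow> real" where
  "CKN_rhs p \<theta> u = (\<integral>x. field_integrand p \<theta> (grad u) x \<partial>lborel) powr (1 / \<theta>)"

definition radial_lhs :: "real \<Rightarrow> real \<Rightarrow> (real^'n \<Rightarrow> real) \<Rightarrow> real" where
  "radial_lhs pstar \<theta> u = (\<integral>x. fun_integrand pstar \<theta> u x \<partial>lborel)"

definition radial_rhs :: "real \<Rightarrow> real \<Rightarrow> (real^'n \<Rightarrow> real) \<Rightarrow> real" where
  "radial_rhs p \<theta> u = (\<integral>x. field_integrand p \<theta> (grad_r u) x \<partial>lborel)"

definition A_integrand_lhs ::
  "real \<Rightarrow> real \<Rightarrow> real \<Rightarrow> real \<Rightarrow> real \<Rightarrow> (real^'n \<Rightarrow> real) \<Rightarrow> real^'n \<Rightarrow> real" where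
  "A_integrand_lhs pstar q R \<theta> \<sigma> = log_integrand pstar q R \<sigma> (1 + (\<theta> - 1) / \<theta> * \<sigma>)"

definition A_integrand_rhs ::
  "real \<Rightarrow> real \<Rightarrow> real \<Rightarrow> real \<Rightarrow> (real^'n \<Rightarrow> real) \<Rightarrow> real^'n \<Rightarrow> real" where
  "A_integrand_rhs p q R \<theta> u = field_integrand p \<theta> (L_op q R u)"

definition A_lhs :: "real \<Rightarrow> real \<Rightarrow> real \<Rightarrow> real \<Rightarrow> real \<Rightarrow> (real^'n \<Rightarrow> real) \<Rightarrow> real" where
  "A_lhs pstar q R \<theta> \<sigma> u =
     (LINT x:ball 0 R|lborel. A_integrand_lhs pstar q R \<theta> \<sigma> u x) powr (1 / \<sigma>)"

definition A_rhs :: "real \<Rightarrow> real \<Rightarrow> real \<Rightarrow> real \<Rightarrow> (real^'n \<Rightarrow> real) \<Rightarrow> real" where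
  "A_rhs p q R \<theta> u = (LINT x:ball 0 R|lborel. A_integrand_rhs p q R \<theta> u x) powr (1 / \<theta>)"

definition B_integrand_lhs ::
  "real \<Rightarrow> real \<Rightarrow> real \<Rightarrow> real \<Rightarrow> (real^'n \<Rightarrow> real) \<Rightarrow> real^'n \<Rightarrow> real" where
  "B_integrand_lhs pstar q R \<theta> = log_integrand pstar q R \<theta> \<theta>"

definition B_integrand_rhs :: "real \<Rightarrow> real \<Rightarrow> (real^'n \<Rightarrow> real) \<Rightarrow> real^'n \<Rightarrow> real" where
  "B_integrand_rhs p \<theta> u = field_integrand p \<theta> (grad_r u)"

definition B_lhs :: "real \<Rightarrow> real \<Rightarrow> real \<Rightarrow> real \<Rightarrow> (real^'n \<Rightarrow> real) \<Rightarrow> real" where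
  "B_lhs pstar q R \<theta> u = (LINT x:ball 0 R|lborel. B_integrand_lhs pstar q R \<theta> u x)"

definition B_rhs :: "real \<Rightarrow> real \<Rightarrow> real \<Rightarrow> (real^'n \<Rightarrow> real) \<Rightarrow> real" where
  "B_rhs p R \<theta> u = (LINT x:ball 0 R|lborel. B_integrand_rhs p \<theta> u x)"

text \<open>For \<open>0 < norm x < R\<close> and \<open>l > 0\<close> the base of the outer power is positive. The scaled
  function is used only on the ball of radius \<open>R\<close>; it need not be differentiable at the origin.\<close>

definition scaled_point :: "real \<Rightarrow> real \<Rightarrow> real \<Rightarrow> real \<Rightarrow> real^'n \<Rightarrow> real^'n" where
  "scaled_point p \<theta> R l x =
     (l * norm x powr (- ((real CARD('n) - p) / p * (\<theta> / (\<theta> - 1))))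
       + (1 - l) * R powr (- ((real CARD('n) - p) / p * (\<theta> / (\<theta> - 1)))))
       powr (- (p / (real CARD('n) - p) * ((\<theta> - 1) / \<theta>)))
     *\<^sub>R (x /\<^sub>R norm x)"

definition scaled_fun ::
  "real \<Rightarrow> real \<Rightarrow> real \<Rightarrow> real \<Rightarrow> (real^'n \<Rightarrow> real) \<Rightarrow> real^'n \<Rightarrow> real" where
  "scaled_fun p \<theta> R l u x = l powr (- ((\<theta> - 1) / \<theta>)) * u (scaled_point p \<theta> R l x)"

text \<open>The Bochner integral of a non-integrable function is zero by convention, so finiteness of
  the two integrals is recorded alongside the inequalities.\<close>

definition A_finite ::
  "real \<Rightarrow> real \<Rightarrow> real \<Rightarrow> real \<Rightarrow> real \<Rightarrow> real \<Rightarrow> (real^'n \<Rightarrow> real) \<Rightarrow> bool" where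
  "A_finite p pstar q R \<theta> \<sigma> u \<longleftrightarrow>
     set_integrable lborel (ball 0 R) (A_integrand_lhs pstar q R \<theta> \<sigma> u) \<and>
     set_integrable lborel (ball 0 R) (A_integrand_rhs p q R \<theta> u)"

definition B_finite ::
  "real \<Rightarrow> real \<Rightarrow> real \<Rightarrow> real \<Rightarrow> real \<Rightarrow> (real^'n \<Rightarrow> real) \<Rightarrow> bool" where
  "B_finite p pstar q R \<theta> u \<longleftrightarrow>
     set_integrable lborel (ball 0 R) (B_integrand_lhs pstar q R \<theta> u) \<and>
     set_integrable lborel (ball 0 R) (B_integrand_rhs p \<theta> u)"

end

theory Submission
  imports Defs "HOL-Real_Asymp.Real_Asymp"
begin

text \<open>
  Write \<open>\<alpha> = a \<theta> / (\<theta> - 1)\<close> with \<open>a = (n - p) / p\<close>, so that \<open>q = 1 + \<alpha>\<close> and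
  \<open>(q - 1) log\<^sub>q (R / |x|) = 1 - (|x| / R)\<^sup>\<alpha>\<close>. The radial map sending \<open>x\<close> to the point \<open>y\<close> in the same
  direction with \<open>|y| powr -\<alpha> = |x| powr -\<alpha> - R powr -\<alpha>\<close> takes the punctured ball onto the punctured
  space, and pulling back along it turns both sides of the Caffarelli--Kohn--Nirenberg inequality into
  both sides of (A), and the radial inequality into (B). More generally, the maps
  \<open>|y| powr -\<alpha> = l |x| powr -\<alpha> + b\<close> permute the inequalities with weight \<open>1 + c |x| powr \<alpha>\<close>, \<open>c \<le> 0\<close>; the case
  \<open>c = 0\<close> is the whole space, \<open>c = - (R powr -\<alpha>)\<close> is the ball, and the maps preserving \<open>c\<close> are the
  scaling of the theorem.

  These maps are smooth only away from the origin, so test functions are first multiplied by a smooth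
  radial cutoff vanishing near the origin. Removing the cutoff costs nothing in the limit, because
  \<open>|x| |\<nabla>\<phi>|\<close> stays bounded and \<open>|x| powr (a \<theta> - n)\<close> is integrable at the origin.
\<close>

section \<open>Smooth functions on open sets\<close>

text \<open>In the variable s = \<open>|x| powr -\<alpha>\<close> the weight is (s + c) / s, and the
  affine change s -> l s + b carries the weight with parameter c to the one with c' when b + c' = l
  c. The map stretches tangential directions by m = |y| / |x| and the radial one by k m, where k =
  \<open>l * m powr \<alpha>\<close>, and the two weights at corresponding points also differ by the
  factor k. So dividing the tangential gradient by the weight makes the whole field scale by a
  single factor, although the map is not conformal. Balancing the other powers of k against the
  Jacobian m^n k leaves the condition \<alpha> (\<theta> - 1) / \<theta> = a and the prefactor
  \<open>l powr -((\<theta> - 1) / \<theta>)\<close>; this is the origin of \<alpha>, and so of q.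
  Inequality and sharpness come together: the transfer between c = 0 and the ball works both ways,
  so both inequalities admit the same constants, namely those up to the supremum. The scaled
  functions of the theorem need not be smooth at the origin; their integrability is read off from
  the change of variables, which is therefore stated as an equivalence.\<close>

lemma differentiable_GDERIV_grad:
  fixes u :: "real^'n \<Rightarrow> real"
  assumes "u differentiable (at x)"
  shows "GDERIV u x :> grad u x"
proof -
  obtain D where D: "(u has_derivative D) (at x)"
    using assms by (auto simp: differentiable_def)
  then have "linear D" by (rule has_derivative_linear)
  \<comment> \<open>The adjoint evaluated at 1 is the Riesz representative of the functional
    \<open>D\<close>; it is the vector that the \<open>THE\<close> in \<open>grad\<close> has to
    pick.\<close>
  then have "D = (\<lambda>h. inner h (adjoint D 1))"
    by (simp add: fun_eq_iff adjoint_works)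
  then have 1: "GDERIV u x :> adjoint D 1"
    using D by (simp add: gderiv_def)
  have 2: "D1 = D2" if "GDERIV u x :> D1" "GDERIV u x :> D2" for D1 D2
  proof -
    have "(\<lambda>h. inner h D1) = (\<lambda>h. inner h D2)"
      using that unfolding gderiv_def by (rule has_derivative_unique)
    then show ?thesis by (simp add: fun_eq_iff vector_eq_ldot)
  qed
  show ?thesis unfolding grad_def using 1 by (rule theI) (rule 2[OF _ 1])
qed

lemma GDERIV_imp_grad:
  fixes u :: "real^'n \<Rightarrow> real"
  assumes "GDERIV u x :> D"
  shows "u differentiable (at x)" "grad u x = D"
proof -
  show *: "u differentiable (at x)"
    using assms by (auto simp: gderiv_def differentiable_def)
  have "(\<lambda>h. inner h (grad u x)) = (\<lambda>h. inner h D)"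
    using differentiable_GDERIV_grad[OF *] assms unfolding gderiv_def by (rule has_derivative_unique)
  then show "grad u x = D" by (simp add: fun_eq_iff vector_eq_ldot)
qed

lemma GDERIV_transform_open:
  assumes "GDERIV u x :> D" "open U" "x \<in> U" "\<And>y. y \<in> U \<Longrightarrow> u y = v y"
  shows "GDERIV v x :> D"
  using assms unfolding gderiv_def by (metis has_derivative_transform_within_open)

lemma grad_transform_open:
  fixes u v :: "real^'n \<Rightarrow> real"
  assumes "open U" "x \<in> U" "\<And>y. y \<in> U \<Longrightarrow> u y = v y"
  shows "u differentiable (at x) \<longleftrightarrow> v differentiable (at x)" "grad u x = grad v x"
proof -
  have *: "GDERIV u x :> D \<longleftrightarrow> GDERIV v x :> D" for D
  proof
    assume "GDERIV u x :> D"
    then show "GDERIV v x :> D" using assms by (rule GDERIV_transform_open)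
  next
    assume "GDERIV v x :> D"
    then show "GDERIV u x :> D" using assms(1,2) by (rule GDERIV_transform_open) (simp add: assms(3))
  qed
  show "grad u x = grad v x" unfolding grad_def * ..
  show "u differentiable (at x) \<longleftrightarrow> v differentiable (at x)"
  proof
    assume "u differentiable (at x)"
    from this[THEN differentiable_GDERIV_grad] show "v differentiable (at x)"
      unfolding * by (rule GDERIV_imp_grad(1))
  next
    assume "v differentiable (at x)"
    from this[THEN differentiable_GDERIV_grad] show "u differentiable (at x)"
      unfolding *[symmetric] by (rule GDERIV_imp_grad(1))
  qed
qed

text \<open>\<open>C_k\<close> demands smoothness on the whole space, while the radial maps are
  smooth only off the origin. Differentiability is still taken \<open>at x\<close>, not within
  \<open>U\<close>, so for open \<open>U\<close> the notion is local and agrees with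
  \<open>C_k\<close> when \<open>U = UNIV\<close>.\<close>

primrec C_k_on :: "nat \<Rightarrow> (real^'n) set \<Rightarrow> (real^'n \<Rightarrow> real) \<Rightarrow> bool" where
  "C_k_on 0 U u \<longleftrightarrow> continuous_on U u"
| "C_k_on (Suc k) U u \<longleftrightarrow> (\<forall>x\<in>U. u differentiable (at x)) \<and> (\<forall>i. C_k_on k U (\<lambda>x. grad u x $ i))"

lemma C_k_on_UNIV: "C_k_on k UNIV u \<longleftrightarrow> C_k k u"
  by (induction k arbitrary: u) auto

lemma C_k_on_cong:
  assumes "open U" "\<And>x. x \<in> U \<Longrightarrow> u x = v x"
  shows "C_k_on k U u \<longleftrightarrow> C_k_on k U v"
  using assms(2)
proof (induction k arbitrary: u v)
  case 0
  then show ?case by (simp cong: continuous_on_cong)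
next
  case (Suc k)
  have "C_k_on k U (\<lambda>x. grad u x $ i) \<longleftrightarrow> C_k_on k U (\<lambda>x. grad v x $ i)" for i
    by (rule Suc.IH) (metis Suc.prems assms(1) grad_transform_open(2))
  moreover have "u differentiable (at x) \<longleftrightarrow> v differentiable (at x)" if "x \<in> U" for x
    using Suc.prems assms(1) grad_transform_open(1) that by metis
  ultimately show ?case by auto
qed

lemma C_k_on_SucI:
  assumes "open U" "\<And>x. x \<in> U \<Longrightarrow> GDERIV u x :> D x" "\<And>i. C_k_on k U (\<lambda>x. D x $ i)"
  shows "C_k_on (Suc k) U u"
proof -
  have "C_k_on k U (\<lambda>x. grad u x $ i) \<longleftrightarrow> C_k_on k U (\<lambda>x. D x $ i)" for i
    by (intro C_k_on_cong assms(1)) (metis GDERIV_imp_grad(2) assms(2))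
  moreover have "u differentiable (at x)" if "x \<in> U" for x
    using assms(2)[OF that] by (rule GDERIV_imp_grad(1))
  ultimately show ?thesis using assms(3) by simp
qed

lemma C_k_on_imp_continuous_on: "C_k_on k U u \<Longrightarrow> continuous_on U u"
  by (cases k) (simp_all add: differentiable_imp_continuous_on differentiable_on_def differentiable_at_withinI)

lemma C_k_on_Suc_imp: "C_k_on (Suc k) U u \<Longrightarrow> C_k_on k U u"
proof (induction k arbitrary: u)
  case 0
  then have "continuous_on U u" by (rule C_k_on_imp_continuous_on)
  then show ?case by simp
next
  case (Suc k)
  have "C_k_on k U (\<lambda>x. grad u x $ i)" for i
    using Suc.prems by (intro Suc.IH) simp
  with Suc.prems show ?case by simp
qed

lemma C_k_on_subset: "C_k_on k U u \<Longrightarrow> V \<subseteq> U \<Longrightarrow> C_k_on k V u"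
proof (induction k arbitrary: u)
  case 0
  then show ?case by (simp add: continuous_on_subset)
next
  case (Suc k)
  have "C_k_on k V (\<lambda>x. grad u x $ i)" for i
    using Suc.prems by (intro Suc.IH) simp_all
  with Suc.prems show ?case by (simp add: subset_iff)
qed

lemma C_k_on_Un:
  "open U \<Longrightarrow> open V \<Longrightarrow> C_k_on k U u \<Longrightarrow> C_k_on k V u \<Longrightarrow> C_k_on k (U \<union> V) u"
proof (induction k arbitrary: u)
  case 0
  then show ?case by (simp add: continuous_on_open_Un)
next
  case (Suc k)
  have "C_k_on k (U \<union> V) (\<lambda>x. grad u x $ i)" for i
    using Suc.prems by (intro Suc.IH) simp_all
  with Suc.prems show ?case by (simp add: ball_Un)
qed

lemma C_k_on_const: "open U \<Longrightarrow> C_k_on k U (\<lambda>x. a)"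
proof (induction k arbitrary: a)
  case (Suc k)
  then show ?case by (intro C_k_on_SucI[where D="\<lambda>_. 0"]) (auto intro: GDERIV_const)
qed simp

lemma C_k_on_component:
  fixes U :: "(real^'n) set"
  assumes "open U"
  shows "C_k_on k U (\<lambda>x. x $ i)"
proof (cases k)
  case 0
  then show ?thesis by (simp add: continuous_on_component)
next
  case (Suc m)
  have *: "GDERIV (\<lambda>x. x $ i) x :> axis i 1" for x :: "real^'n"
    unfolding gderiv_def inner_axis by (simp add: bounded_linear_imp_has_derivative bounded_linear_vec_nth)
  have "C_k_on m U (\<lambda>x. axis i 1 $ j)" for j
    using assms by (rule C_k_on_const)
  with assms * show ?thesis unfolding Suc by (rule C_k_on_SucI)
qed

lemma C_k_on_add:
  "open U \<Longrightarrow> C_k_on k U u \<Longrightarrow> C_k_on k U v \<Longrightarrow> C_k_on k U (\<lambda>x. u x + v x)"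
proof (induction k arbitrary: u v)
  case (Suc k)
  show ?case
  proof (rule C_k_on_SucI[where D="\<lambda>x. grad u x + grad v x"])
    show "GDERIV (\<lambda>x. u x + v x) x :> grad u x + grad v x" if "x \<in> U" for x
      using Suc.prems that by (intro GDERIV_add differentiable_GDERIV_grad) auto
    have "C_k_on k U (\<lambda>x. grad u x $ i + grad v x $ i)" for i
      by (rule Suc.IH) (use Suc.prems in simp_all)
    then show "C_k_on k U (\<lambda>x. (grad u x + grad v x) $ i)" for i by simp
  qed fact
qed (simp add: continuous_on_add)

lemma C_k_on_mult:
  "open U \<Longrightarrow> C_k_on k U u \<Longrightarrow> C_k_on k U v \<Longrightarrow> C_k_on k U (\<lambda>x. u x * v x)"
proof (induction k arbitrary: u v)
  case (Suc k)
  have uv: "C_k_on k U u" "C_k_on k U v" using Suc.prems(2,3)[THEN C_k_on_Suc_imp] .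
  show ?case
  proof (rule C_k_on_SucI[where D="\<lambda>x. u x *\<^sub>R grad v x + v x *\<^sub>R grad u x"])
    show "GDERIV (\<lambda>x. u x * v x) x :> u x *\<^sub>R grad v x + v x *\<^sub>R grad u x" if "x \<in> U" for x
      using Suc.prems that by (intro GDERIV_mult differentiable_GDERIV_grad) auto
    have "C_k_on k U (\<lambda>x. u x * grad v x $ i + v x * grad u x $ i)" for i
      using Suc.prems uv by (intro C_k_on_add Suc.IH) simp_all
    then show "C_k_on k U (\<lambda>x. (u x *\<^sub>R grad v x + v x *\<^sub>R grad u x) $ i)" for i by simp
  qed fact
qed (simp add: continuous_on_mult)

lemma C_k_on_sum:
  "finite I \<Longrightarrow> open U \<Longrightarrow> (\<And>i. i \<in> I \<Longrightarrow> C_k_on k U (u i)) \<Longrightarrow> C_k_on k U (\<lambda>x. \<Sum>i\<in>I. u i x)"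
proof (induction rule: finite_induct)
  case (insert i I)
  then show ?case by (simp add: C_k_on_add)
qed (simp add: C_k_on_const)

text \<open>\<open>F\<close> is a whole tower of successive derivatives: differentiating the
  composite moves from \<open>F m\<close> to \<open>F (Suc m)\<close> and stays inside the family,
  so the induction runs with \<open>m\<close> arbitrary.\<close>

lemma C_k_on_compose_real:
  assumes "open U" "\<And>k t. t \<in> I \<Longrightarrow> DERIV (F k) t :> F (Suc k) t"
    and "C_k_on k U u" "\<And>x. x \<in> U \<Longrightarrow> u x \<in> I"
  shows "C_k_on k U (\<lambda>x. F m (u x))"
  using assms(3)
proof (induction k arbitrary: m)
  case 0
  have "continuous_on I (F m)"
    using assms(2) by (meson DERIV_isCont continuous_at_imp_continuous_on)
  then show ?case
    using 0 assms(4) by (simp add: continuous_on_compose2[of I "F m" U u] image_subset_iff)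
next
  case (Suc k)
  show ?case
  proof (rule C_k_on_SucI[where D="\<lambda>x. F (Suc m) (u x) *\<^sub>R grad u x"])
    show "GDERIV (\<lambda>x. F m (u x)) x :> F (Suc m) (u x) *\<^sub>R grad u x" if "x \<in> U" for x
      using Suc.prems that assms(2,4)
      by (intro GDERIV_DERIV_compose differentiable_GDERIV_grad) auto
    have "C_k_on k U (\<lambda>x. F (Suc m) (u x) * grad u x $ i)" for i
      using Suc.prems C_k_on_Suc_imp[OF Suc.prems] by (intro C_k_on_mult assms(1) Suc.IH) simp_all
    then show "C_k_on k U (\<lambda>x. (F (Suc m) (u x) *\<^sub>R grad u x) $ i)" for i by simp
  qed fact
qed

lemma C_k_on_powr:
  assumes "open U" "C_k_on k U u" "\<And>x. x \<in> U \<Longrightarrow> u x > 0"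
  shows "C_k_on k U (\<lambda>x. u x powr a)"
proof -
  define F where "F k t = (\<Prod>j<k. a - real j) * t powr (a - real k)" for k t
  have "DERIV (F k) t :> F (Suc k) t" if "t \<in> {0<..}" for k and t :: real
    using that unfolding F_def
    by (auto intro!: derivative_eq_intros simp: algebra_simps)
  from C_k_on_compose_real[where F=F and m=0 and I="{0<..}", OF assms(1) this assms(2)] assms(3)
  show ?thesis by (simp add: F_def)
qed

text \<open>By the chain rule each gradient component of the composite is a sum of products of a
  component of \<open>grad w\<close>, again composed with \<open>\<Phi>\<close>, and a partial
  derivative of \<open>\<Phi>\<close>. The induction hypothesis handles the first factor because
  \<open>w\<close> is arbitrary in it.\<close>

lemma C_k_on_compose:
  fixes \<Phi> :: "real^'m \<Rightarrow> real^'n"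
  assumes "open U" "open V"
    and "\<And>j. C_k_on k U (\<lambda>x. \<Phi> x $ j)" "\<And>x. x \<in> U \<Longrightarrow> \<Phi> x \<in> V" "C_k_on k V w"
  shows "C_k_on k U (\<lambda>x. w (\<Phi> x))"
  using assms(3,5)
proof (induction k arbitrary: w)
  case 0
  then have "continuous_on U \<Phi>"
    using continuous_on_vec_lambda[of U "\<lambda>j x. \<Phi> x $ j"] by simp
  then show ?case
    using 0 assms(4) by (simp add: continuous_on_compose2[of V w U \<Phi>] image_subset_iff)
next
  case (Suc k)
  have "GDERIV (\<lambda>x. w (\<Phi> x)) x :> (\<Sum>j\<in>UNIV. grad w (\<Phi> x) $ j *\<^sub>R grad (\<lambda>x. \<Phi> x $ j) x)"
    if "x \<in> U" for x
  proof -
    have "((\<lambda>x. \<Phi> x $ j) has_derivative (\<lambda>h. inner h (grad (\<lambda>x. \<Phi> x $ j) x))) (at x)" for j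
      using differentiable_GDERIV_grad Suc.prems that by (auto simp: gderiv_def)
    then have \<Phi>: "(\<Phi> has_derivative (\<lambda>h. \<chi> j. inner h (grad (\<lambda>x. \<Phi> x $ j) x))) (at x)"
      unfolding has_derivative_componentwise_within[of \<Phi>] Basis_vec_def
      by (auto simp: inner_axis)
    have "(w has_derivative (\<lambda>h. inner h (grad w (\<Phi> x)))) (at (\<Phi> x))"
      using differentiable_GDERIV_grad[of w "\<Phi> x"] Suc.prems assms(4)[OF that] by (simp add: gderiv_def)
    from has_derivative_compose[OF \<Phi> this]
    have "((\<lambda>x. w (\<Phi> x)) has_derivative
        (\<lambda>h. inner (\<chi> j. inner h (grad (\<lambda>x. \<Phi> x $ j) x)) (grad w (\<Phi> x)))) (at x)" .
    also have "(\<lambda>h. inner (\<chi> j. inner h (grad (\<lambda>x. \<Phi> x $ j) x)) (grad w (\<Phi> x)))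
        = (\<lambda>h. inner h (\<Sum>j\<in>UNIV. grad w (\<Phi> x) $ j *\<^sub>R grad (\<lambda>x. \<Phi> x $ j) x))"
    proof
      fix h
      have "inner (\<chi> j. inner h (grad (\<lambda>x. \<Phi> x $ j) x)) (grad w (\<Phi> x))
          = (\<Sum>j\<in>UNIV. inner h (grad (\<lambda>x. \<Phi> x $ j) x) * grad w (\<Phi> x) $ j)"
        unfolding inner_vec_def[of "vec_lambda _"] by simp
      also have "\<dots> = inner h (\<Sum>j\<in>UNIV. grad w (\<Phi> x) $ j *\<^sub>R grad (\<lambda>x. \<Phi> x $ j) x)"
        unfolding inner_sum_right by (simp add: mult.commute)
      finally show "inner (\<chi> j. inner h (grad (\<lambda>x. \<Phi> x $ j) x)) (grad w (\<Phi> x)) = \<dots>" .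
    qed
    finally show ?thesis unfolding gderiv_def .
  qed
  moreover have "C_k_on k U (\<lambda>x. (\<Sum>j\<in>UNIV. grad w (\<Phi> x) $ j *\<^sub>R grad (\<lambda>x. \<Phi> x $ j) x) $ i)" for i
  proof -
    have "C_k_on k U (\<lambda>x. grad w (\<Phi> x) $ j)" for j
      by (rule Suc.IH[OF C_k_on_Suc_imp[OF Suc.prems(1)]]) (use Suc.prems(2) in simp)
    moreover have "C_k_on k U (\<lambda>x. grad (\<lambda>x. \<Phi> x $ j) x $ i)" for j
      using Suc.prems(1) by simp
    ultimately have "C_k_on k U (\<lambda>x. \<Sum>j\<in>UNIV. grad w (\<Phi> x) $ j * grad (\<lambda>x. \<Phi> x $ j) x $ i)"
      by (intro C_k_on_sum C_k_on_mult assms(1) finite)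
    then show ?thesis by simp
  qed
  ultimately show ?case by (intro C_k_on_SucI assms(1))
qed

lemma C_k_on_norm_powr:
  assumes "open U" "0 \<notin> U"
  shows "C_k_on k U (\<lambda>x. norm x powr a)"
proof -
  have "C_k_on k U (\<lambda>x. (\<Sum>i\<in>UNIV. x $ i * x $ i) powr (a / 2))"
    using assms by (intro C_k_on_powr C_k_on_sum C_k_on_mult C_k_on_component)
      (auto simp flip: inner_real_def inner_vec_def)
  also have "(\<lambda>x::real^'a. (\<Sum>i\<in>UNIV. x $ i * x $ i) powr (a / 2)) = (\<lambda>x. norm x powr a)"
    by (simp add: norm_eq_sqrt_inner inner_vec_def powr_half_sqrt[symmetric] powr_powr sum_nonneg)
  finally show ?thesis .
qed

section \<open>A smooth function vanishing on a half-line\<close>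

definition flat :: "real \<Rightarrow> real" where
  "flat t = (if t > 0 then exp (- 1 / t) else 0)"

text \<open>The derivatives of exp (-1/t) have the form P(s) exp (-s) with s = 1/t. Since ds/dt =
  -s^2, one more derivative replaces P by s^2 (P - P').\<close>

primrec flat_poly :: "nat \<Rightarrow> real poly" where
  "flat_poly 0 = 1"
| "flat_poly (Suc k) = monom 1 2 * (flat_poly k - pderiv (flat_poly k))"

definition flat_deriv :: "nat \<Rightarrow> real \<Rightarrow> real" where
  "flat_deriv k t = (if t > 0 then poly (flat_poly k) (1 / t) * exp (- 1 / t) else 0)"

lemma flat_deriv_0: "flat_deriv 0 = flat"
  by (simp add: flat_deriv_def flat_def fun_eq_iff)

lemma poly_exp_tendsto_0: "((\<lambda>s::real. poly P s * exp (- s)) \<longlongrightarrow> 0) at_top"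
proof -
  have "((\<lambda>s. \<Sum>i\<le>degree P. coeff P i * (s ^ i / exp s)) \<longlongrightarrow> (\<Sum>i\<le>degree P. coeff P i * 0)) at_top"
    by (intro tendsto_intros tendsto_power_div_exp_0)
  then show ?thesis
    by (simp add: poly_altdef sum_divide_distrib exp_minus divide_inverse sum_distrib_right mult.assoc)
qed

lemma DERIV_flat_deriv: "DERIV (flat_deriv k) t :> flat_deriv (Suc k) t"
proof -
  consider "t > 0" | "t < 0" | "t = 0" by linarith
  then show ?thesis
  proof cases
    case 1
    have "DERIV (\<lambda>t. poly (flat_poly k) (1 / t) * exp (- 1 / t)) t :> flat_deriv (Suc k) t"
      using 1 by (auto intro!: derivative_eq_intros DERIV_chain'[OF _ poly_DERIV]
          simp: flat_deriv_def poly_monom field_simps power2_eq_square)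
    then show ?thesis
      by (rule has_field_derivative_transform_within_open[where S="{0<..}"]) (use 1 in \<open>auto simp: flat_deriv_def\<close>)
  next
    case 2
    have "DERIV (\<lambda>t. 0) t :> flat_deriv (Suc k) t" using 2 by (simp add: flat_deriv_def)
    then show ?thesis
      by (rule has_field_derivative_transform_within_open[where S="{..<0}"]) (use 2 in \<open>auto simp: flat_deriv_def\<close>)
  next
    case 3
    \<comment> \<open>With s = 1/h the right difference quotient at 0 is s P(s) exp (-s);
      \<open>pCons 0\<close> supplies the factor s that comes from dividing by h.\<close>
    have "((\<lambda>h. poly (pCons 0 (flat_poly k)) (inverse h) * exp (- inverse h)) \<longlongrightarrow> 0) (at_right 0)"
      by (rule filterlim_compose[OF poly_exp_tendsto_0 filterlim_inverse_at_top_right])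
    then have r: "((\<lambda>h. (flat_deriv k h - flat_deriv k 0) / (h - 0)) \<longlongrightarrow> 0) (at_right 0)"
      by (rule Lim_transform_eventually)
        (auto simp: flat_deriv_def eventually_at_filter field_simps intro!: always_eventually)
    have l: "((\<lambda>h. (flat_deriv k h - flat_deriv k 0) / (h - 0)) \<longlongrightarrow> 0) (at_left 0)"
      by (rule Lim_transform_eventually[OF tendsto_const])
        (auto simp: flat_deriv_def eventually_at_filter intro!: always_eventually)
    have "((\<lambda>h. (flat_deriv k h - flat_deriv k 0) / (h - 0)) \<longlongrightarrow> 0) (at 0)"
      using l r by (simp add: filterlim_split_at)
    then show ?thesis using 3 by (simp add: has_field_derivative_iff flat_deriv_def)
  qed
qed

lemma C_k_on_flat: "open U \<Longrightarrow> C_k_on k U u \<Longrightarrow> C_k_on k U (\<lambda>x. flat (u x))"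
  using C_k_on_compose_real[where F=flat_deriv and m=0 and I=UNIV] DERIV_flat_deriv
  by (simp add: flat_deriv_0)

section \<open>Change of variables for radial maps\<close>

text \<open>The library's change-of-variables theorem needs a well-ordered index type. Radial maps commute with
  relabelling coordinates, so it suffices to transfer them to an arbitrarily ordered copy of the index type.\<close>

typedef 'n ordered = "UNIV :: 'n set" ..

lemma bij_Rep_ordered: "bij Rep_ordered"
  by (rule bijI') (auto simp: Rep_ordered_inject intro: Abs_ordered_inverse[OF UNIV_I, symmetric])

instance ordered :: (finite) finite
  by intro_classes (simp add: bij_betw_finite[OF bij_Rep_ordered])

instantiation ordered :: (finite) wellorder
begin

definition less_eq_ordered :: "'a ordered \<Rightarrow> 'a ordered \<Rightarrow> bool" where
  "i \<le> j \<longleftrightarrow> to_nat_on UNIV (Rep_ordered i) \<le> to_nat_on UNIV (Rep_ordered j)"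

definition less_ordered :: "'a ordered \<Rightarrow> 'a ordered \<Rightarrow> bool" where
  "i < j \<longleftrightarrow> to_nat_on UNIV (Rep_ordered i) < to_nat_on UNIV (Rep_ordered j)"

instance
proof
  fix P :: "'a ordered \<Rightarrow> bool" and a
  assume "\<And>x. (\<And>y. y < x \<Longrightarrow> P y) \<Longrightarrow> P x"
  then show "P a"
    unfolding less_ordered_def by (induction "to_nat_on UNIV (Rep_ordered a)" arbitrary: a rule: less_induct) auto
qed (auto simp: less_eq_ordered_def less_ordered_def countable_finite Rep_ordered_inject)

end

definition reindex :: "real^'n \<Rightarrow> real^'n ordered" where
  "reindex x = (\<chi> j. x $ Rep_ordered j)"

definition unindex :: "real^'n ordered \<Rightarrow> real^'n" where
  "unindex y = (\<chi> j. y $ Abs_ordered j)"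

lemma unindex_reindex [simp]: "unindex (reindex x) = x"
  by (simp add: unindex_def reindex_def Abs_ordered_inverse vec_eq_iff)

lemma reindex_unindex [simp]: "reindex (unindex x) = x"
  by (simp add: unindex_def reindex_def Rep_ordered_inverse vec_eq_iff)

lemma inner_reindex [simp]: "inner (reindex x) (reindex y) = inner x y"
  unfolding inner_vec_def reindex_def
  by (simp add: sum.reindex_bij_betw[OF bij_Rep_ordered, of "\<lambda>i. x $ i * y $ i"])

lemma norm_reindex [simp]: "norm (reindex x) = norm x"
  by (simp add: norm_eq_sqrt_inner)

lemma norm_unindex [simp]: "norm (unindex y) = norm y"
  by (metis norm_reindex reindex_unindex)

lemma unindex_scaleR: "unindex (a *\<^sub>R x) = a *\<^sub>R unindex x"
  by (simp add: unindex_def vec_eq_iff)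

lemma continuous_on_unindex [continuous_intros]: "continuous_on S unindex"
  unfolding unindex_def by (intro continuous_intros)

lemma measurable_unindex [measurable]: "unindex \<in> borel_measurable borel"
  by (intro borel_measurable_continuous_onI continuous_on_unindex)

lemma prod_Basis_vec:
  fixes g :: "real^'n \<Rightarrow> 'b::comm_monoid_mult"
  shows "prod g Basis = (\<Prod>i\<in>UNIV. g (axis i 1))"
proof -
  have 1: "(Basis :: (real^'n) set) = range (\<lambda>i. axis i 1)"
    by (auto simp: Basis_vec_def)
  have 2: "inj (\<lambda>i. axis i 1 :: real^'n)"
    by (auto simp: inj_on_def axis_eq_axis)
  show ?thesis unfolding 1 by (simp add: prod.reindex[OF 2])
qed

text \<open>Lebesgue measure is determined by its values on boxes, and relabelling the coordinates
  only permutes the side lengths of a box.\<close>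

lemma lborel_unindex: "distr lborel borel unindex = (lborel :: (real^'n) measure)"
proof (rule lborel_eqI[symmetric])
  fix l u :: "real^'n"
  assume *: "\<And>b. b \<in> Basis \<Longrightarrow> inner l b \<le> inner u b"
  have le: "l $ i \<le> u $ i" for i
    using *[of "axis i 1"] by (simp add: inner_axis axis_in_Basis_iff)
  have "unindex -` box l u = box (reindex l) (reindex u)"
  proof (intro set_eqI)
    fix y :: "real^'n ordered"
    have "y \<in> box (reindex l) (reindex u) \<longleftrightarrow>
        (\<forall>j. l $ Rep_ordered j < y $ j \<and> y $ j < u $ Rep_ordered j)"
      by (simp add: mem_box_cart reindex_def)
    also have "\<dots> \<longleftrightarrow> (\<forall>i. l $ i < y $ Abs_ordered i \<and> y $ Abs_ordered i < u $ i)"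
      by (metis Abs_ordered_inverse Rep_ordered_inverse UNIV_I)
    finally show "y \<in> unindex -` box l u \<longleftrightarrow> y \<in> box (reindex l) (reindex u)"
      by (simp add: mem_box_cart unindex_def)
  qed
  then have "emeasure (distr lborel borel unindex) (box l u) = emeasure lborel (box (reindex l) (reindex u))"
    by (subst emeasure_distr) auto
  also have "\<dots> = (\<Prod>b\<in>Basis. inner (reindex u - reindex l) b)"
    using le by (intro emeasure_lborel_box)
      (auto simp: Basis_vec_def inner_axis reindex_def)
  also have "(\<Prod>b\<in>Basis. inner (reindex u - reindex l) b) = (\<Prod>j\<in>UNIV. (u - l) $ Rep_ordered j)"
    by (subst prod_Basis_vec) (simp add: reindex_def inner_axis)
  also have "\<dots> = (\<Prod>i\<in>UNIV. (u - l) $ i)"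
    by (rule prod.reindex_bij_betw[OF bij_Rep_ordered])
  also have "\<dots> = (\<Prod>b\<in>Basis. inner (u - l) b)"
    by (subst prod_Basis_vec) (simp add: inner_axis)
  finally show "emeasure (distr lborel borel unindex) (box l u) = (\<Prod>b\<in>Basis. inner (u - l) b)" .
qed simp

text \<open>The map acts as \<open>a\<close> on the hyperplane orthogonal to \<open>x\<close> and as
  \<open>a + b * (norm x)\<^sup>2\<close> along \<open>x\<close>. An orthogonal map sending a
  multiple of a basis vector to \<open>x\<close> conjugates it to a diagonal matrix.\<close>

lemma det_rank_one_update:
  fixes x :: "real^'n"
  shows "det (matrix (\<lambda>h. a *\<^sub>R h + (b * inner x h) *\<^sub>R x)) = a ^ (CARD('n) - 1) * (a + b * (norm x)\<^sup>2)"
proof -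
  obtain k :: 'n where True by simp
  define e :: "real^'n" where "e = norm x *\<^sub>R axis k 1"
  have "norm e = norm x" by (simp add: e_def)
  then obtain f where f: "orthogonal_transformation f" "f e = x"
    by (metis orthogonal_transformation_exists)
  then have lf: "linear f" by (simp add: orthogonal_transformation_linear)
  have of: "inner (f y) (f z) = inner y z" for y z
    using f by (simp add: orthogonal_transformation_def)
  define D where "D = (\<lambda>h. a *\<^sub>R h + (b * inner e h) *\<^sub>R e)"
  have lD: "linear D" unfolding D_def
    by (intro linearI) (simp_all add: algebra_simps)
  have axis_entry: "(axis i 1 :: real^'n) $ j = (if j = i then 1 else 0)" for i j
    by (simp add: axis_def)
  have D_entry: "matrix D $ i $ j =
      (if i = j then a else 0) + (if i = k \<and> j = k then b * (norm x)\<^sup>2 else 0)" for i j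
    by (simp add: matrix_def D_def e_def inner_axis_axis axis_entry power2_eq_square)
  define L where "L = (\<lambda>h. a *\<^sub>R h + (b * inner x h) *\<^sub>R x)"
  have lL: "linear L" unfolding L_def
    by (intro linearI) (simp_all add: algebra_simps)
  have "L \<circ> f = f \<circ> D"
    using lf of[of e] f(2)
    by (simp add: fun_eq_iff L_def D_def linear_add linear_cmul)
  then have "matrix L ** matrix f = matrix f ** matrix D"
    using matrix_compose[OF lf lL] matrix_compose[OF lD lf] by simp
  then have "det (matrix L) * det (matrix f) = det (matrix f) * det (matrix D)"
    by (metis det_mul)
  moreover have "det (matrix f) \<noteq> 0"
    using f(1) by (metis abs_0 det_orthogonal_matrix orthogonal_transformation_matrix zero_neq_one zero_neq_neg_one)
  ultimately have "det (matrix L) = det (matrix D)" by simp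
  also have "\<dots> = (\<Prod>i\<in>UNIV. matrix D $ i $ i)"
    by (rule det_diagonal) (auto simp: D_entry)
  also have "(\<lambda>i. matrix D $ i $ i) = (\<lambda>i. if i = k then a + b * (norm x)\<^sup>2 else a)"
    by (simp add: fun_eq_iff D_entry)
  also have "(\<Prod>i\<in>UNIV. if i = k then a + b * (norm x)\<^sup>2 else a) = a ^ (CARD('n) - 1) * (a + b * (norm x)\<^sup>2)"
    by (simp add: prod.If_cases Compl_eq_Diff_UNIV card_Diff_singleton mult.commute)
  finally show ?thesis unfolding L_def .
qed

lemma has_derivative_radial:
  fixes x :: "'a::real_inner"
  assumes "x \<noteq> 0" "(m has_real_derivative d) (at (norm x))"
  shows "((\<lambda>x. m (norm x) *\<^sub>R x) has_derivative
    (\<lambda>h. m (norm x) *\<^sub>R h + (d / norm x * inner x h) *\<^sub>R x)) (at x)"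
proof -
  have "((\<lambda>x. m (norm x)) has_derivative (\<lambda>h. inner h (d *\<^sub>R sgn x))) (at x)"
    using GDERIV_DERIV_compose[OF GDERIV_norm[OF assms(1)] assms(2)] unfolding gderiv_def .
  from has_derivative_scaleR[OF this has_derivative_ident] show ?thesis
    by (rule has_derivative_eq_rhs)
      (simp add: fun_eq_iff sgn_div_norm inner_commute divide_inverse mult.commute mult.left_commute)
qed

text \<open>A bridge from absolute integrability, in which the change-of-variables theorem is
  phrased, to Borel integrals: the function times the indicator of \<open>U\<close> is Borel
  measurable, and for such functions \<open>lborel\<close> and its completion give the same
  integral.\<close>

lemma set_integrable_continuous_iff_lebesgue:
  fixes f :: "'a::euclidean_space \<Rightarrow> real"
  assumes "open U" "continuous_on U f"
  shows "set_integrable lborel U f \<longleftrightarrow> f absolutely_integrable_on U"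
    and "f absolutely_integrable_on U \<Longrightarrow> (LINT x:U|lborel. f x) = integral U f"
proof -
  have m: "(\<lambda>x. indicator U x *\<^sub>R f x) \<in> borel_measurable lborel"
    using borel_measurable_continuous_on_indicator[OF _ assms(2)] assms(1) by simp
  show "set_integrable lborel U f \<longleftrightarrow> f absolutely_integrable_on U"
    unfolding set_integrable_def using integrable_completion[OF m] by simp
  show "(LINT x:U|lborel. f x) = integral U f" if "f absolutely_integrable_on U"
    using set_lebesgue_integral_eq_integral(2)[OF that] integral_completion[OF m]
    unfolding set_lebesgue_integral_def by simp
qed

text \<open>\<open>J\<close> is the Jacobian determinant: one factor m(r) for each of the n - 1
  tangential directions, and the derivative of r m(r) for the radial one.\<close>

lemma radial_change_of_variables_ordered:
  fixes U V :: "(real^'n::{finite,wellorder}) set" and m m' :: "real \<Rightarrow> real"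
  defines "\<Phi> \<equiv> \<lambda>x::real^'n::_. m (norm x) *\<^sub>R x"
    and "J \<equiv> \<lambda>x::real^'n::_. m (norm x) ^ (CARD('n::_) - 1) * (m (norm x) + norm x * m' (norm x))"
  assumes "open U" "0 \<notin> U" "open V" and inj: "inj_on \<Phi> U" and V: "\<Phi> ` U = V"
    and der: "\<And>x. x \<in> U \<Longrightarrow> (m has_real_derivative m' (norm x)) (at (norm x))"
    and J: "continuous_on U J" "\<And>x. x \<in> U \<Longrightarrow> J x \<ge> 0"
    and f: "continuous_on V f"
  shows "set_integrable lborel U (\<lambda>x. J x * f (\<Phi> x)) \<longleftrightarrow> set_integrable lborel V f"
    and "(LINT x:U|lborel. J x * f (\<Phi> x)) = (LINT y:V|lborel. f y)"
proof -
  define D where "D x = (\<lambda>h. m (norm x) *\<^sub>R h + (m' (norm x) / norm x * inner x h) *\<^sub>R x)" for x :: "real^'n::_"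
  have D: "(\<Phi> has_derivative D x) (at x)" if "x \<in> U" for x
    unfolding \<Phi>_def D_def using that der \<open>0 \<notin> U\<close> by (intro has_derivative_radial) auto
  have det: "\<bar>det (matrix (D x))\<bar> = J x" if "x \<in> U" for x
  proof -
    have "det (matrix (D x)) = J x"
      unfolding D_def det_rank_one_update J_def using that \<open>0 \<notin> U\<close> by (auto simp: power2_eq_square)
    with J(2)[OF that] show ?thesis by simp
  qed
  have cont: "continuous_on U (\<lambda>x. J x * f (\<Phi> x))"
  proof (intro continuous_on_mult J)
    have "continuous_on U \<Phi>"
      by (rule has_derivative_continuous_on[OF has_derivative_at_withinI[OF D]])
    then show "continuous_on U (\<lambda>x. f (\<Phi> x))"
      by (rule continuous_on_compose2[OF f]) (simp add: V)
  qed
  \<comment> \<open>The theorem applied here is about vector-valued integrands, so \<open>f\<close>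
    is routed through \<open>real^1\<close>.\<close>
  have "(\<lambda>x. \<bar>det (matrix (D x))\<bar> *\<^sub>R vec (f (\<Phi> x)) :: real^1) absolutely_integrable_on U \<and>
       integral U (\<lambda>x. \<bar>det (matrix (D x))\<bar> *\<^sub>R vec (f (\<Phi> x))) = (vec b :: real^1) \<longleftrightarrow>
      (\<lambda>y. vec (f y) :: real^1) absolutely_integrable_on \<Phi> ` U \<and>
       integral (\<Phi> ` U) (\<lambda>y. vec (f y)) = (vec b :: real^1)" for b
    using D \<open>open U\<close> inj
    by (intro has_absolute_integral_change_of_variables) (auto intro: has_derivative_at_withinI)
  then have "(\<lambda>x. \<bar>det (matrix (D x))\<bar> * f (\<Phi> x)) absolutely_integrable_on U \<and>
       integral U (\<lambda>x. \<bar>det (matrix (D x))\<bar> * f (\<Phi> x)) = b \<longleftrightarrow>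
      f absolutely_integrable_on \<Phi> ` U \<and> integral (\<Phi> ` U) f = b" for b
    by (simp add: absolutely_integrable_on_1_iff integral_on_1_eq)
  moreover have "(\<lambda>x. \<bar>det (matrix (D x))\<bar> * f (\<Phi> x)) absolutely_integrable_on U \<longleftrightarrow>
     (\<lambda>x. J x * f (\<Phi> x)) absolutely_integrable_on U"
    using det by (intro set_integrable_cong) auto
  moreover have "integral U (\<lambda>x. \<bar>det (matrix (D x))\<bar> * f (\<Phi> x)) = integral U (\<lambda>x. J x * f (\<Phi> x))"
    using det by (intro integral_cong) auto
  ultimately have cov: "(\<lambda>x. J x * f (\<Phi> x)) absolutely_integrable_on U \<longleftrightarrow> f absolutely_integrable_on V"
    and eq: "f absolutely_integrable_on V \<Longrightarrow> integral U (\<lambda>x. J x * f (\<Phi> x)) = integral V f"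
    using V by auto
  note U = set_integrable_continuous_iff_lebesgue[OF \<open>open U\<close> cont]
  note V' = set_integrable_continuous_iff_lebesgue[OF \<open>open V\<close> f]
  show iff: "set_integrable lborel U (\<lambda>x. J x * f (\<Phi> x)) \<longleftrightarrow> set_integrable lborel V f"
    unfolding U(1) V'(1) by (rule cov)
  show "(LINT x:U|lborel. J x * f (\<Phi> x)) = (LINT y:V|lborel. f y)"
  proof (cases "set_integrable lborel V f")
    case True
    then show ?thesis
      using U(2) V' cov eq by simp
  next
    \<comment> \<open>Without integrability both Bochner integrals are 0 by convention, so the
      equality holds unconditionally.\<close>
    case False
    with iff show ?thesis
      unfolding set_integrable_def set_lebesgue_integral_def
      by (simp add: not_integrable_integral_eq)
  qed
qed

lemma set_integral_unindex:
  fixes f :: "real^'n \<Rightarrow> real"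
  assumes "open U" "continuous_on U f"
  shows "set_integrable lborel (unindex -` U) (\<lambda>y. f (unindex y)) \<longleftrightarrow> set_integrable lborel U f"
    and "(LINT y:unindex -` U|lborel. f (unindex y)) = (LINT x:U|lborel. f x)"
proof -
  have m: "(\<lambda>x. indicator U x *\<^sub>R f x) \<in> borel_measurable borel"
    using borel_measurable_continuous_on_indicator[OF _ assms(2)] assms(1) by simp
  have i: "(\<lambda>y. indicator (unindex -` U) y *\<^sub>R f (unindex y)) = (\<lambda>y. indicator U (unindex y) *\<^sub>R f (unindex y))"
    by (simp add: fun_eq_iff indicator_def)
  show "set_integrable lborel (unindex -` U) (\<lambda>y. f (unindex y)) \<longleftrightarrow> set_integrable lborel U f"
    unfolding set_integrable_def i
    by (subst (2) lborel_unindex[symmetric], subst integrable_distr_eq) (use m in auto)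
  show "(LINT y:unindex -` U|lborel. f (unindex y)) = (LINT x:U|lborel. f x)"
    unfolding set_lebesgue_integral_def i
    by (subst (2) lborel_unindex[symmetric], subst integral_distr) (use m in auto)
qed

lemma radial_change_of_variables:
  fixes U V :: "(real^'n) set" and m m' :: "real \<Rightarrow> real"
  defines "\<Phi> \<equiv> \<lambda>x::real^'n. m (norm x) *\<^sub>R x"
    and "J \<equiv> \<lambda>x::real^'n. m (norm x) ^ (CARD('n) - 1) * (m (norm x) + norm x * m' (norm x))"
  assumes "open U" "0 \<notin> U" "open V" and inj: "inj_on \<Phi> U" and V: "\<Phi> ` U = V"
    and der: "\<And>x. x \<in> U \<Longrightarrow> (m has_real_derivative m' (norm x)) (at (norm x))"
    and J: "continuous_on U J" "\<And>x. x \<in> U \<Longrightarrow> J x \<ge> 0"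
    and f: "continuous_on V f"
  shows "set_integrable lborel U (\<lambda>x. J x * f (\<Phi> x)) \<longleftrightarrow> set_integrable lborel V f"
    and "(LINT x:U|lborel. J x * f (\<Phi> x)) = (LINT y:V|lborel. f y)"
proof -
  define \<Psi> where "\<Psi> = (\<lambda>y::real^'n ordered. m (norm y) *\<^sub>R y)"
  define K where "K = (\<lambda>y::real^'n ordered. m (norm y) ^ (CARD('n ordered) - 1) * (m (norm y) + norm y * m' (norm y)))"
  have card: "CARD('n ordered) = CARD('n)"
    using bij_betw_same_card[OF bij_Rep_ordered] .
  have u\<Psi>: "unindex (\<Psi> y) = \<Phi> (unindex y)" and uK: "K y = J (unindex y)" for y
    by (simp_all add: \<Psi>_def \<Phi>_def K_def J_def card unindex_scaleR)
  have img: "\<Psi> ` (unindex -` U) = unindex -` V"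
  proof safe
    fix y assume "unindex y \<in> U"
    then show "\<Psi> y \<in> unindex -` V" using V u\<Psi> by auto
  next
    fix y assume "unindex y \<in> V"
    then obtain x where x: "x \<in> U" "unindex y = \<Phi> x" using V by auto
    then have "y = \<Psi> (reindex x)"
      by (metis reindex_unindex u\<Psi> unindex_reindex)
    with x show "y \<in> \<Psi> ` (unindex -` U)" by auto
  qed
  have inj': "inj_on \<Psi> (unindex -` U)"
    using inj unfolding inj_on_def by (metis reindex_unindex u\<Psi> vimageE)
  have op: "open (unindex -` U)" "open (unindex -` V)"
    using assms by (auto intro!: open_vimage continuous_on_unindex)
  have z: "0 \<notin> unindex -` U"
    using \<open>0 \<notin> U\<close> by (metis norm_eq_zero norm_unindex vimageE)
  have der': "(m has_real_derivative m' (norm y)) (at (norm y))" if "y \<in> unindex -` U" for y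
    using der[of "unindex y"] that by simp
  have K: "continuous_on (unindex -` U) K" "\<And>y. y \<in> unindex -` U \<Longrightarrow> K y \<ge> 0"
    using J continuous_on_compose2[OF J(1) continuous_on_unindex, of "unindex -` U"] by (auto simp: uK)
  have g: "continuous_on (unindex -` V) (\<lambda>y. f (unindex y))"
    using continuous_on_compose2[OF f continuous_on_unindex, of "unindex -` V"] by auto
  note cov = radial_change_of_variables_ordered[OF op(1) z op(2) inj'[unfolded \<Psi>_def] img[unfolded \<Psi>_def]
      der' K[unfolded K_def] g]
  have cov1: "set_integrable lborel (unindex -` U) (\<lambda>y. K y * f (unindex (\<Psi> y))) \<longleftrightarrow>
      set_integrable lborel (unindex -` V) (\<lambda>y. f (unindex y))"
    unfolding K_def \<Psi>_def by (rule cov(1))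
  have cov2: "(LINT y:unindex -` U|lborel. K y * f (unindex (\<Psi> y))) = (LINT y:unindex -` V|lborel. f (unindex y))"
    unfolding K_def \<Psi>_def by (rule cov(2))
  have \<Phi>: "continuous_on U \<Phi>"
    unfolding \<Phi>_def using der \<open>0 \<notin> U\<close>
    by (intro has_derivative_continuous_on[OF has_derivative_at_withinI[OF has_derivative_radial]]) auto
  have cont: "continuous_on U (\<lambda>x. J x * f (\<Phi> x))"
    by (intro continuous_on_mult J continuous_on_compose2[OF f \<Phi>]) (simp add: V)
  show "set_integrable lborel U (\<lambda>x. J x * f (\<Phi> x)) \<longleftrightarrow> set_integrable lborel V f"
    using cov1 set_integral_unindex(1)[OF \<open>open U\<close> cont] set_integral_unindex(1)[OF \<open>open V\<close> f]
    by (simp add: uK u\<Psi>)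
  show "(LINT x:U|lborel. J x * f (\<Phi> x)) = (LINT y:V|lborel. f y)"
    using cov2 set_integral_unindex(2)[OF \<open>open U\<close> cont] set_integral_unindex(2)[OF \<open>open V\<close> f]
    by (simp add: uK u\<Psi>)
qed

section \<open>The weighted functionals under radial maps\<close>

text \<open>The parameter \<open>a\<close> stands for (n - p) / p = n / p*, hence
  \<open>a + 1\<close> for n / p. Keeping \<open>\<delta>\<close> as a parameter lets one
  development serve both (A) and (B).\<close>

locale ckn =
  fixes a \<theta> \<sigma> \<delta> :: real
  assumes a_pos: "0 < a" and \<theta>_gt_1: "1 < \<theta>" and \<sigma>_pos: "0 < \<sigma>"
begin

definition \<alpha> :: real where "\<alpha> = a * \<theta> / (\<theta> - 1)"

lemma \<alpha>_pos: "0 < \<alpha>"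
  using a_pos \<theta>_gt_1 by (simp add: \<alpha>_def)

definition wt :: "real \<Rightarrow> real^'n \<Rightarrow> real" where
  "wt c x = 1 + c * norm x powr \<alpha>"

definition dom :: "real \<Rightarrow> (real^'n) set" where
  "dom c = {x. wt c x > 0}"

text \<open>\<open>\<delta> = 1\<close> gives the field of (A), and the full gradient for \<open>c = 0\<close>; \<open>\<delta> = 0\<close> gives the radial derivative of (B).\<close>

definition field :: "real \<Rightarrow> (real^'n \<Rightarrow> real) \<Rightarrow> real^'n \<Rightarrow> real^'n" where
  "field c u x = (\<delta> / wt c x) *\<^sub>R grad_S u x + grad_r u x"

definition Fint :: "real \<Rightarrow> (real^'n \<Rightarrow> real) \<Rightarrow> real^'n \<Rightarrow> real" where
  "Fint c u x = norm x powr (a * \<sigma>) * \<bar>u x\<bar> powr \<sigma> / wt c x powr (1 + (\<theta> - 1) / \<theta> * \<sigma>) / norm x ^ CARD('n)"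

definition Gint :: "real \<Rightarrow> (real^'n \<Rightarrow> real) \<Rightarrow> real^'n \<Rightarrow> real" where
  "Gint c u x = norm x powr ((a + 1) * \<theta>) * norm (field c u x) powr \<theta> / norm x ^ CARD('n)"

definition F :: "real \<Rightarrow> (real^'n \<Rightarrow> real) \<Rightarrow> real" where
  "F c u = (LINT x:dom c|lborel. Fint c u x)"

definition G :: "real \<Rightarrow> (real^'n \<Rightarrow> real) \<Rightarrow> real" where
  "G c u = (LINT x:dom c|lborel. Gint c u x)"

definition radial_map :: "real \<Rightarrow> real \<Rightarrow> real^'n \<Rightarrow> real^'n" where
  "radial_map l b x = (l * norm x powr (- \<alpha>) + b) powr (- (1 / \<alpha>)) *\<^sub>R (x /\<^sub>R norm x)"

text \<open>The quotient of the radii of image and argument, which is the stretch factor of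
  \<open>radial_map\<close> in the tangential directions.\<close>

definition stretch :: "real \<Rightarrow> real \<Rightarrow> real \<Rightarrow> real" where
  "stretch l b r = (l * r powr (- \<alpha>) + b) powr (- (1 / \<alpha>)) / r"

lemma radial_map_eq: "radial_map l b x = stretch l b (norm x) *\<^sub>R x"
  by (simp add: radial_map_def stretch_def divide_inverse)

lemma Fint_0 [simp]: "Fint c u 0 = 0" and Gint_0 [simp]: "Gint c u 0 = 0"
  by (simp_all add: Fint_def Gint_def)

lemma Fint_nonneg: "0 \<le> Fint c u x" and Gint_nonneg: "0 \<le> Gint c u x"
  by (simp_all add: Fint_def Gint_def)

lemma continuous_on_wt: "continuous_on S (wt c)"
  unfolding wt_def using \<alpha>_pos
  by (intro continuous_on_add continuous_on_mult continuous_on_const continuous_on_powr' continuous_on_norm continuous_on_id) auto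

lemma open_dom: "open (dom c)"
  unfolding dom_def by (intro open_Collect_less continuous_on_const continuous_on_wt)

lemma open_punctured_dom: "open (dom c - {0})"
  by (intro open_Diff open_dom closed_singleton)

lemma F_nonneg: "0 \<le> F c u" and G_nonneg: "0 \<le> G c u"
  unfolding F_def G_def set_lebesgue_integral_def
  by (auto intro!: integral_nonneg_AE simp: Fint_nonneg Gint_nonneg)

text \<open>Both integrands are exactly 0 at the origin, because \<open>0 powr z = 0\<close>;
  removing the point therefore changes nothing, and the radial maps need only be studied off
  it.\<close>

lemma F_punctured: "set_integrable lborel (dom c) (Fint c u) \<longleftrightarrow> set_integrable lborel (dom c - {0}) (Fint c u)"
    "F c u = (LINT x:dom c - {0}|lborel. Fint c u x)"
  and G_punctured: "set_integrable lborel (dom c) (Gint c u) \<longleftrightarrow> set_integrable lborel (dom c - {0}) (Gint c u)"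
    "G c u = (LINT x:dom c - {0}|lborel. Gint c u x)"
proof -
  have "(\<lambda>x. indicator (dom c) x *\<^sub>R Fint c u x) = (\<lambda>x. indicator (dom c - {0}) x *\<^sub>R Fint c u x)"
    by (auto simp: fun_eq_iff indicator_def)
  then show "set_integrable lborel (dom c) (Fint c u) \<longleftrightarrow> set_integrable lborel (dom c - {0}) (Fint c u)"
    "F c u = (LINT x:dom c - {0}|lborel. Fint c u x)"
    by (simp_all add: F_def set_integrable_def set_lebesgue_integral_def)
  have "(\<lambda>x. indicator (dom c) x *\<^sub>R Gint c u x) = (\<lambda>x. indicator (dom c - {0}) x *\<^sub>R Gint c u x)"
    by (auto simp: fun_eq_iff indicator_def)
  then show "set_integrable lborel (dom c) (Gint c u) \<longleftrightarrow> set_integrable lborel (dom c - {0}) (Gint c u)"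
    "G c u = (LINT x:dom c - {0}|lborel. Gint c u x)"
    by (simp_all add: G_def set_integrable_def set_lebesgue_integral_def)
qed

text \<open>Positivity of the weight says that \<open>l * norm x powr (- \<alpha>) + l * c\<close>
  is positive on the domain. The base in question is larger than this by \<open>- c'\<close>, which
  is where the sign of \<open>c'\<close> enters.\<close>

lemma base_pos:
  assumes "l > 0" "c' \<le> 0" "b + c' = l * c" "x \<in> dom c - {0}"
  shows "l * norm x powr (- \<alpha>) + b > 0"
proof -
  have "l * norm x powr (- \<alpha>) * wt c x > 0"
    using assms by (simp add: dom_def)
  also have "l * norm x powr (- \<alpha>) * wt c x = l * norm x powr (- \<alpha>) + l * c"
    using assms by (simp add: wt_def algebra_simps powr_add[symmetric])
  finally show ?thesis using assms by simp
qed

context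
  fixes l b c c' :: real
  assumes l: "l > 0" and c': "c' \<le> 0" and bc: "b + c' = l * c"
begin

lemma stretch_pos: "x \<in> dom c - {0} \<Longrightarrow> stretch l b (norm x) > 0"
  using base_pos[OF l c' bc, of x] by (simp add: stretch_def)

lemma norm_radial_map: "x \<in> dom c - {0} \<Longrightarrow> norm (radial_map l b x) = stretch l b (norm x) * norm x"
  using stretch_pos[of x] by (simp add: radial_map_eq)

lemma norm_radial_map_powr:
  assumes "x \<in> dom c - {0}"
  shows "norm (radial_map l b x) powr (- \<alpha>) = l * norm x powr (- \<alpha>) + b"
proof -
  have "norm (radial_map l b x) = (l * norm x powr (- \<alpha>) + b) powr (- (1 / \<alpha>))"
    using assms by (simp add: radial_map_def)
  then show ?thesis
    using base_pos[OF l c' bc assms] \<alpha>_pos by (simp add: powr_powr)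
qed

lemma wt_radial_map:
  assumes "x \<in> dom c - {0}"
  shows "wt c' (radial_map l b x) = l * stretch l b (norm x) powr \<alpha> * wt c x"
proof -
  let ?s = "norm (radial_map l b x)"
  have s: "?s > 0" using norm_radial_map[OF assms] stretch_pos[OF assms] assms by simp
  have "wt c' (radial_map l b x) = ?s powr \<alpha> * (?s powr (- \<alpha>) + c')"
    using s by (simp add: wt_def algebra_simps powr_add[symmetric])
  also have "?s powr (- \<alpha>) + c' = l * norm x powr (- \<alpha>) * wt c x"
    unfolding norm_radial_map_powr[OF assms]
    using assms bc by (simp add: wt_def algebra_simps powr_add[symmetric])
  also have "?s powr \<alpha> = stretch l b (norm x) powr \<alpha> * norm x powr \<alpha>"
    unfolding norm_radial_map[OF assms] using stretch_pos[OF assms] by (simp add: powr_mult)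
  also have "stretch l b (norm x) powr \<alpha> * norm x powr \<alpha> * (l * norm x powr (- \<alpha>) * wt c x)
      = (norm x powr \<alpha> * norm x powr (- \<alpha>)) * (l * stretch l b (norm x) powr \<alpha> * wt c x)"
    by (simp only: ac_simps)
  also have "norm x powr \<alpha> * norm x powr (- \<alpha>) = 1"
    using assms by (simp add: powr_add[symmetric])
  finally show ?thesis by simp
qed

lemma radial_map_in_dom: "x \<in> dom c - {0} \<Longrightarrow> radial_map l b x \<in> dom c' - {0}"
  using wt_radial_map[of x] stretch_pos[of x] l by (auto simp: dom_def radial_map_eq)

lemma radial_map_inverse:
  assumes "x \<in> dom c - {0}"
  shows "radial_map (1 / l) (- b / l) (radial_map l b x) = x"
proof -
  let ?y = "radial_map l b x"
  have "(1 / l * norm ?y powr (- \<alpha>) + (- b / l)) = norm x powr (- \<alpha>)"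
    unfolding norm_radial_map_powr[OF assms] using l by (simp add: field_simps)
  then have "radial_map (1 / l) (- b / l) ?y = norm x *\<^sub>R (?y /\<^sub>R norm ?y)"
    unfolding radial_map_def[of "1 / l"] using \<alpha>_pos assms by (simp add: powr_powr)
  also have "?y /\<^sub>R norm ?y = x /\<^sub>R norm x"
    unfolding norm_radial_map[OF assms] unfolding radial_map_eq using stretch_pos[OF assms] assms by simp
  finally show ?thesis using assms by simp
qed

end

text \<open>The inverse of s -> l s + b is s -> s / l - b / l. It satisfies the same compatibility
  relation with \<open>c\<close> and \<open>c'\<close> exchanged, so everything known about the map
  applies to its inverse.\<close>

lemma inverse_parameters:
  fixes l b c c' :: real
  assumes "l > 0" "b + c' = l * c"
  shows "1 / l > 0" "- b / l + c = (1 / l) * c'"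
proof -
  show "1 / l > 0" using assms by simp
  have "c = (b + c') / l" using assms by simp
  then show "- b / l + c = (1 / l) * c'" by (simp add: add_divide_distrib)
qed

lemma radial_map_bij:
  assumes "l > 0" "c' \<le> 0" "c \<le> 0" "b + c' = l * c"
  shows "inj_on (radial_map l b) (dom c - {0})" "radial_map l b ` (dom c - {0}) = dom c' - {0}"
proof -
  note inv = inverse_parameters[OF assms(1,4)]
  show "inj_on (radial_map l b) (dom c - {0})"
    using radial_map_inverse[OF assms(1,2,4)] by (rule inj_on_inverseI)
  have "y \<in> radial_map l b ` (dom c - {0})" if y: "y \<in> dom c' - {0}" for y
  proof
    show "radial_map (1 / l) (- b / l) y \<in> dom c - {0}"
      by (rule radial_map_in_dom[OF inv(1) assms(3) inv(2) y])
    show "y = radial_map l b (radial_map (1 / l) (- b / l) y)"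
      using radial_map_inverse[OF inv(1) assms(3) inv(2) y] assms(1) by simp
  qed
  then show "radial_map l b ` (dom c - {0}) = dom c' - {0}"
    by (intro equalityI image_subsetI subsetI) (rule radial_map_in_dom[OF assms(1,2,4)])
qed

text \<open>Write y = m r. Differentiating
  \<open>y powr -\<alpha> = l * r powr -\<alpha> + b\<close> gives dy/dr =
  \<open>l * m powr (\<alpha> + 1)\<close>; solving m + r m' = dy/dr for m' gives the
  formula.\<close>

lemma DERIV_stretch:
  assumes "r > 0" "l * r powr (- \<alpha>) + b > 0"
  shows "(stretch l b has_real_derivative (l * stretch l b r powr \<alpha> - 1) * stretch l b r / r) (at r)"
proof -
  define B where "B = l * r powr (- \<alpha>) + b"
  have B: "B > 0" using assms(2) by (simp add: B_def)
  have "((\<lambda>r. l * r powr (- \<alpha>) + b) has_real_derivative l * (- \<alpha> * r powr (- \<alpha> - 1))) (at r)"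
    by (rule DERIV_cong[OF DERIV_add[OF DERIV_cmult[OF has_real_derivative_powr[OF assms(1)]] DERIV_const]]) simp
  from DERIV_divide[OF DERIV_fun_powr[OF this assms(2), of "- (1 / \<alpha>)"] DERIV_ident]
  have "(stretch l b has_real_derivative
      ((- (1 / \<alpha>)) * B powr (- (1 / \<alpha>) - 1) * (l * (- \<alpha> * r powr (- \<alpha> - 1))) * r - B powr (- (1 / \<alpha>))) / (r * r)) (at r)"
    unfolding stretch_def[abs_def] B_def using assms by simp
  also have "((- (1 / \<alpha>)) * B powr (- (1 / \<alpha>) - 1) * (l * (- \<alpha> * r powr (- \<alpha> - 1))) * r - B powr (- (1 / \<alpha>))) / (r * r)
      = (l * (r powr (- \<alpha>) / B) - 1) * (B powr (- (1 / \<alpha>)) / r) / r"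
  proof -
    have 1: "B powr (- (1 / \<alpha>) - 1) = B powr (- (1 / \<alpha>)) / B"
      and 2: "r powr (- \<alpha> - 1) = r powr (- \<alpha>) / r"
      using powr_diff[of B "- (1 / \<alpha>)" 1] powr_diff[of r "- \<alpha>" 1] B assms(1) by simp_all
    define P where "P = B powr (- (1 / \<alpha>))"
    show ?thesis
      unfolding 1 2 P_def[symmetric] using assms(1) B \<alpha>_pos by (simp add: field_simps)
  qed
  also have "r powr (- \<alpha>) / B = (B powr (- (1 / \<alpha>)) / r) powr \<alpha>"
  proof -
    have "(B powr (- (1 / \<alpha>)) / r) powr \<alpha> = B powr (- 1) / r powr \<alpha>"
      using assms(1) \<alpha>_pos by (simp add: powr_divide powr_powr)
    then show ?thesis using B by (simp add: powr_minus_divide)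
  qed
  finally show ?thesis unfolding stretch_def[of l b r] B_def .
qed

text \<open>The identity that fixes the exponent of the weight: \<open>l m\<^sup>\<alpha>\<close> is the factor by which the map stretches
  in the radial direction relative to the tangential ones, where \<open>m\<close> is the tangential stretch.\<close>

lemma conformal_factor:
  assumes "l > 0" "m > 0"
  shows "l powr (- ((\<theta> - 1) / \<theta>)) * (l * m powr \<alpha>) powr ((\<theta> - 1) / \<theta>) = m powr a"
proof -
  have "\<alpha> * ((\<theta> - 1) / \<theta>) = a"
    using \<theta>_gt_1 by (simp add: \<alpha>_def)
  then have "(l * m powr \<alpha>) powr ((\<theta> - 1) / \<theta>) = l powr ((\<theta> - 1) / \<theta>) * m powr a"
    using assms by (simp add: powr_mult powr_powr)
  moreover have "l powr (- ((\<theta> - 1) / \<theta>)) * l powr ((\<theta> - 1) / \<theta>) = 1"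
    using assms by (simp add: powr_add[symmetric])
  ultimately show ?thesis by (simp add: mult.assoc[symmetric])
qed

context
  fixes l b c c' :: real
  assumes l: "l > 0" and c': "c' \<le> 0" and c: "c \<le> 0" and bc: "b + c' = l * c"
begin

lemma has_derivative_radial_map:
  assumes "x \<in> dom c - {0}"
  shows "(radial_map l b has_derivative (\<lambda>h. stretch l b (norm x) *\<^sub>R h +
    ((l * stretch l b (norm x) powr \<alpha> - 1) * stretch l b (norm x) / norm x / norm x * inner x h) *\<^sub>R x)) (at x)"
proof -
  have "((\<lambda>x. stretch l b (norm x) *\<^sub>R x) has_derivative (\<lambda>h. stretch l b (norm x) *\<^sub>R h +
    ((l * stretch l b (norm x) powr \<alpha> - 1) * stretch l b (norm x) / norm x / norm x * inner x h) *\<^sub>R x)) (at x)"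
    using assms base_pos[OF l c' bc assms] by (intro has_derivative_radial DERIV_stretch) auto
  then show ?thesis by (simp add: radial_map_eq[abs_def])
qed

context
  fixes u w :: "real^'n \<Rightarrow> real" and \<kappa> :: real
  assumes uw: "\<And>x. x \<in> dom c - {0} \<Longrightarrow> u x = \<kappa> * w (radial_map l b x)"
begin

text \<open>With e = x / |x| and k = \<open>l * m powr \<alpha>\<close>, the derivative of the
  radial map is m times the sum of the identity and (k - 1) times the projection onto e. This
  operator is self-adjoint, so it also carries the gradient of \<open>w\<close> to that of
  \<open>u\<close>, up to the factor \<open>\<kappa>\<close>.\<close>

lemma GDERIV_pullback:
  assumes x: "x \<in> dom c - {0}" and w: "w differentiable (at (radial_map l b x))"
  defines "v \<equiv> grad w (radial_map l b x)" and "m \<equiv> stretch l b (norm x)"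
  shows "GDERIV u x :> (\<kappa> * m) *\<^sub>R (v + ((l * m powr \<alpha> - 1) * inner (x /\<^sub>R norm x) v) *\<^sub>R (x /\<^sub>R norm x))"
proof -
  have "(w has_derivative (\<lambda>h. inner h v)) (at (radial_map l b x))"
    using differentiable_GDERIV_grad[OF w] unfolding v_def gderiv_def .
  from has_derivative_mult_right[OF has_derivative_compose[OF has_derivative_radial_map[OF x] this], of \<kappa>]
  have "GDERIV (\<lambda>x. \<kappa> * w (radial_map l b x)) x :>
      (\<kappa> * m) *\<^sub>R (v + ((l * m powr \<alpha> - 1) * inner (x /\<^sub>R norm x) v) *\<^sub>R (x /\<^sub>R norm x))"
    unfolding gderiv_def
    by (rule has_derivative_eq_rhs)
      (simp add: fun_eq_iff m_def inner_left_distrib inner_right_distrib inner_commute[of x] divide_inverse algebra_simps)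
  then show ?thesis
    by (rule GDERIV_transform_open[OF _ open_punctured_dom x]) (simp add: uw)
qed

text \<open>The tangential gradient picks up the factor m and the radial one k m. The weight at the
  image point is k times the weight at \<open>x\<close>, so dividing by the weight gives the
  tangential part its missing factor k.\<close>

lemma field_pullback:
  assumes x: "x \<in> dom c - {0}" and w: "w differentiable (at (radial_map l b x))"
  defines "m \<equiv> stretch l b (norm x)"
  shows "field c u x = (\<kappa> * (l * m powr \<alpha>) * m) *\<^sub>R field c' w (radial_map l b x)"
proof -
  let ?y = "radial_map l b x"
  define k where "k = l * m powr \<alpha>"
  define e where "e = x /\<^sub>R norm x"
  define v where "v = grad w ?y"
  have m: "m > 0" using stretch_pos[OF l c' bc x] by (simp add: m_def)
  then have k: "k > 0" using l by (simp add: k_def)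
  have e: "inner e e = 1"
    using x by (simp add: e_def flip: power2_norm_eq_inner)
  have ye: "?y /\<^sub>R norm ?y = e"
    unfolding norm_radial_map[OF l c' bc x] unfolding radial_map_eq using m x by (simp add: e_def m_def)
  have gu: "grad u x = (\<kappa> * m) *\<^sub>R (v + ((k - 1) * inner e v) *\<^sub>R e)"
    using GDERIV_imp_grad(2)[OF GDERIV_pullback[OF x w]] unfolding m_def e_def v_def k_def .
  have gr: "grad_r u x = (\<kappa> * m * k * inner e v) *\<^sub>R e"
    unfolding grad_r_def gu e_def[symmetric] by (simp add: inner_right_distrib e algebra_simps)
  have gS: "grad_S u x = (\<kappa> * m) *\<^sub>R (v - inner e v *\<^sub>R e)"
    unfolding grad_S_def gr gu by (simp add: algebra_simps)
  have gw: "grad_r w ?y = inner e v *\<^sub>R e" "grad_S w ?y = v - inner e v *\<^sub>R e"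
    by (simp_all add: grad_r_def grad_S_def ye v_def)
  have W: "wt c' ?y = k * wt c x"
    unfolding wt_radial_map[OF l c' bc x] k_def m_def ..
  have "(\<delta> / wt c x) * (\<kappa> * m) = \<kappa> * k * m * (\<delta> / (k * wt c x))" "\<kappa> * m * k * inner e v = \<kappa> * k * m * inner e v"
    using k by simp_all
  then show ?thesis
    unfolding field_def k_def[symmetric] gr gS gw W scaleR_add_right scaleR_scaleR by simp
qed

text \<open>Here \<open>J\<close> is m^n k, and m^n cancels against the denominators. In
  \<open>Fint\<close> the remaining k is absorbed by the summand 1 in the weight exponent, and the
  rest of that exponent cancels through
  \<open>\<kappa> * k powr ((\<theta> - 1) / \<theta>) = m powr a\<close>. In \<open>Gint\<close>
  the same identity leaves \<open>k powr (\<theta> - 1)\<close>, which the k of the Jacobian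
  completes to the \<open>k powr \<theta>\<close> coming from the field.\<close>

lemma Fint_Gint_pullback:
  assumes x: "x \<in> dom c - {0}" and w: "w differentiable (at (radial_map l b x))"
    and \<kappa>: "\<kappa> = l powr (- ((\<theta> - 1) / \<theta>))"
  defines "m \<equiv> stretch l b (norm x)"
  defines "J \<equiv> m ^ (CARD('n) - 1) * (m + norm x * ((l * m powr \<alpha> - 1) * m / norm x))"
  shows "Fint c u x = J * Fint c' w (radial_map l b x)" "Gint c u x = J * Gint c' w (radial_map l b x)"
proof -
  let ?y = "radial_map l b x"
  define k where "k = l * m powr \<alpha>"
  define r where "r = norm x"
  have m: "m > 0" using stretch_pos[OF l c' bc x] by (simp add: m_def)
  then have k: "k > 0" using l by (simp add: k_def)
  have r: "r > 0" using x by (simp add: r_def)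
  have \<kappa>0: "\<kappa> > 0" using l \<kappa> by simp
  have "J = m ^ (CARD('n) - 1) * m * k"
  proof -
    have "norm x * ((k - 1) * m / norm x) = (k - 1) * m" using x by simp
    then show ?thesis unfolding J_def k_def[symmetric] by (simp add: algebra_simps)
  qed
  also have "m ^ (CARD('n) - 1) * m = m ^ CARD('n)"
    by (metis zero_less_card_finite power_minus_mult)
  finally have J: "J = m ^ CARD('n) * k" .
  have y: "norm ?y = m * r"
    using norm_radial_map[OF l c' bc x] by (simp add: m_def r_def)
  have W: "wt c' ?y = k * wt c x"
    unfolding wt_radial_map[OF l c' bc x] k_def m_def ..
  have cf: "\<kappa> * k powr ((\<theta> - 1) / \<theta>) = m powr a"
    using conformal_factor[OF l m] by (simp add: \<kappa> k_def)
  have W0: "wt c x > 0" using x by (simp add: dom_def)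
  have 1: "m powr (a * \<sigma>) = \<kappa> powr \<sigma> * k powr ((\<theta> - 1) / \<theta> * \<sigma>)"
  proof -
    have "m powr (a * \<sigma>) = (m powr a) powr \<sigma>" by (simp add: powr_powr)
    also have "\<dots> = \<kappa> powr \<sigma> * k powr ((\<theta> - 1) / \<theta> * \<sigma>)"
      unfolding cf[symmetric] using \<kappa>0 k by (simp add: powr_mult powr_powr)
    finally show ?thesis .
  qed
  define E where "E = (\<theta> - 1) / \<theta> * \<sigma>"
  have kW: "(k * wt c x) powr (1 + E) = k * k powr E * wt c x powr (1 + E)"
    using k W0 by (simp add: powr_mult powr_add)
  have mr: "(m * r) powr (a * \<sigma>) = \<kappa> powr \<sigma> * k powr E * r powr (a * \<sigma>)"
    using m r 1 by (simp add: powr_mult E_def)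
  have kw: "\<bar>\<kappa> * w ?y\<bar> powr \<sigma> = \<kappa> powr \<sigma> * \<bar>w ?y\<bar> powr \<sigma>"
    using \<kappa>0 by (simp add: abs_mult powr_mult)
  show "Fint c u x = J * Fint c' w ?y"
    unfolding Fint_def J y W uw[OF x] r_def[symmetric] E_def[symmetric] kW mr kw power_mult_distrib
    using m k r \<kappa>0 W0 by (simp add: field_simps)
  have "(\<kappa> * k powr ((\<theta> - 1) / \<theta>)) powr \<theta> = (m powr a) powr \<theta>"
    by (simp only: cf)
  then have "m powr (a * \<theta>) = \<kappa> powr \<theta> * k powr (\<theta> - 1)"
    using k \<kappa>0 \<theta>_gt_1 by (simp add: powr_mult powr_powr)
  then have 2: "m powr ((a + 1) * \<theta>) * k = \<kappa> powr \<theta> * k powr \<theta> * m powr \<theta>"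
    using k by (simp add: distrib_right powr_add powr_diff)
  have "norm (field c u x) powr \<theta> = \<kappa> powr \<theta> * k powr \<theta> * m powr \<theta> * norm (field c' w ?y) powr \<theta>"
    using field_pullback[OF x w] k m \<kappa>0 by (simp add: k_def m_def powr_mult)
  then show "Gint c u x = J * Gint c' w ?y"
    using m k r unfolding Gint_def J y r_def[symmetric] 2[symmetric]
    by (simp add: powr_mult power_mult_distrib)
qed

end

end

lemma continuous_on_Fint:
  assumes "continuous_on (dom c - {0}) u"
  shows "continuous_on (dom c - {0}) (Fint c u)"
  unfolding Fint_def using assms \<sigma>_pos
  by (intro continuous_on_divide continuous_on_mult continuous_on_powr' continuous_on_power continuous_on_norm
      continuous_on_wt continuous_on_const continuous_on_id continuous_on_rabs) (auto simp: dom_def)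

lemma continuous_on_grad:
  assumes "C_k_on (Suc 0) U u"
  shows "continuous_on U (grad u)"
  using assms continuous_on_vec_lambda[of U "\<lambda>i x. grad u x $ i"] by simp

lemma continuous_on_Gint:
  assumes "C_k_on (Suc 0) (dom c - {0}) u"
  shows "continuous_on (dom c - {0}) (Gint c u)"
  unfolding Gint_def field_def grad_S_def grad_r_def using continuous_on_grad[OF assms] \<theta>_gt_1
  by (intro continuous_on_divide continuous_on_mult continuous_on_powr' continuous_on_power continuous_on_norm
      continuous_on_wt continuous_on_const continuous_on_id continuous_on_add continuous_on_diff
      continuous_on_scaleR continuous_on_inner continuous_on_inverse) (auto simp: dom_def)

text \<open>Only the punctured domains enter: \<open>w\<close> is regular there, and the
  differentiability of \<open>u\<close> follows from the pullback formula. This admits functions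
  \<open>u\<close> that are singular at the origin.\<close>

lemma F_G_pullback:
  fixes u w :: "real^'n \<Rightarrow> real"
  assumes l: "l > 0" and c': "c' \<le> 0" and c: "c \<le> 0" and bc: "b + c' = l * c"
    and uw: "\<And>x. x \<in> dom c - {0} \<Longrightarrow> u x = l powr (- ((\<theta> - 1) / \<theta>)) * w (radial_map l b x)"
    and w: "C_k_on (Suc 0) (dom c' - {0}) w"
  shows "set_integrable lborel (dom c) (Fint c u) \<longleftrightarrow> set_integrable lborel (dom c') (Fint c' w)"
    and "F c u = F c' w"
    and "set_integrable lborel (dom c) (Gint c u) \<longleftrightarrow> set_integrable lborel (dom c') (Gint c' w)"
    and "G c u = G c' w"
proof -
  define m' where "m' r = (l * stretch l b r powr \<alpha> - 1) * stretch l b r / r" for r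
  define J where "J x = stretch l b (norm x) ^ (CARD('n) - 1) * (stretch l b (norm x) + norm x * m' (norm x))" for x :: "real^'n"
  have wd: "w differentiable (at (radial_map l b x))" if "x \<in> dom c - {0}" for x
    using w radial_map_in_dom[OF l c' bc that] by simp
  have Fp: "Fint c u x = J x * Fint c' w (radial_map l b x)" and Gp: "Gint c u x = J x * Gint c' w (radial_map l b x)"
    if "x \<in> dom c - {0}" for x
    unfolding J_def m'_def
    by (rule Fint_Gint_pullback[OF l c' c bc uw that wd[OF that] refl]; assumption)+
  have der: "(stretch l b has_real_derivative m' (norm x)) (at (norm x))" if "x \<in> dom c - {0}" for x :: "real^'n"
    unfolding m'_def using that base_pos[OF l c' bc that] by (intro DERIV_stretch) auto
  have cs: "continuous_on (dom c - {0}) (\<lambda>x::real^'n. stretch l b (norm x))"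
  proof (rule continuous_at_imp_continuous_on, rule ballI)
    fix x :: "real^'n" assume "x \<in> dom c - {0}"
    from DERIV_isCont[OF der[OF this]] show "isCont (\<lambda>x. stretch l b (norm x)) x"
      by (rule isCont_o2[where f=norm, OF continuous_norm[OF continuous_ident]])
  qed
  have cJ: "continuous_on (dom c - {0}) J"
    unfolding J_def m'_def using stretch_pos[OF l c' bc] \<alpha>_pos
    by (intro continuous_on_divide continuous_on_mult continuous_on_powr' continuous_on_power continuous_on_norm
      continuous_on_const continuous_on_id continuous_on_add continuous_on_diff cs) (auto intro: less_imp_le)
  have J0: "J x \<ge> 0" if "x \<in> dom c - {0}" for x
  proof -
    let ?m = "stretch l b (norm x)"
    have "norm x * m' (norm x) = (l * ?m powr \<alpha> - 1) * ?m"
      using that by (simp add: m'_def)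
    then have "J x = ?m ^ (CARD('n) - 1) * (l * ?m powr \<alpha> * ?m)"
      by (simp add: J_def algebra_simps)
    with stretch_pos[OF l c' bc that] l show ?thesis by simp
  qed
  note bij = radial_map_bij[OF l c' c bc]
  have z: "0 \<notin> dom c - {0}" by simp
  have cw: "continuous_on (dom c' - {0}) w" using w by (rule C_k_on_imp_continuous_on)
  note rcv = radial_change_of_variables[OF open_punctured_dom z open_punctured_dom
    bij[unfolded radial_map_eq[abs_def]] der cJ[unfolded J_def] J0[unfolded J_def]]
  have cov: "set_integrable lborel (dom c - {0}) (\<lambda>x. J x * f (radial_map l b x)) \<longleftrightarrow>
      set_integrable lborel (dom c' - {0}) f"
    "(LINT x:dom c - {0}|lborel. J x * f (radial_map l b x)) = (LINT y:dom c' - {0}|lborel. f y)"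
    if "continuous_on (dom c' - {0}) f" for f
    unfolding J_def radial_map_eq using rcv that by blast+
  show "set_integrable lborel (dom c) (Fint c u) \<longleftrightarrow> set_integrable lborel (dom c') (Fint c' w)"
    unfolding F_punctured cov(1)[OF continuous_on_Fint[OF cw], symmetric]
    by (rule set_integrable_cong) (simp_all add: Fp)
  show "F c u = F c' w"
    unfolding F_punctured cov(2)[OF continuous_on_Fint[OF cw], symmetric]
    by (rule set_lebesgue_integral_cong) (simp_all add: Fp open_punctured_dom borel_open)
  show "set_integrable lborel (dom c) (Gint c u) \<longleftrightarrow> set_integrable lborel (dom c') (Gint c' w)"
    unfolding G_punctured cov(1)[OF continuous_on_Gint[OF w], symmetric]
    by (rule set_integrable_cong) (simp_all add: Gp)
  show "G c u = G c' w"
    unfolding G_punctured cov(2)[OF continuous_on_Gint[OF w], symmetric]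
    by (rule set_lebesgue_integral_cong) (simp_all add: Gp open_punctured_dom borel_open)
qed

end

section \<open>Cutting off near the origin\<close>

lemma C0_infI:
  assumes "\<And>k. C_k_on k UNIV u" "compact K" "K \<subseteq> \<Omega>" "\<And>x. x \<notin> K \<Longrightarrow> u x = 0"
  shows "u \<in> C0_inf \<Omega>"
proof -
  have "support_on UNIV u \<subseteq> K" using assms(4) by (auto simp: support_on_def)
  then have "closure (support_on UNIV u) \<subseteq> K"
    using assms(2) by (simp add: closure_minimal compact_imp_closed)
  moreover have "compact (closure (support_on UNIV u))"
    using compact_Int_closed[OF assms(2) closed_closure, of "support_on UNIV u"] calculation
    by (simp add: inf_absorb2)
  ultimately show ?thesis
    using assms(1,3) by (auto simp: C0_inf_def C_k_on_UNIV)
qed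

lemma C0_infE:
  assumes "u \<in> C0_inf \<Omega>"
  obtains K where "\<forall>k. C_k_on k UNIV u" "compact K" "K \<subseteq> \<Omega>" "\<forall>x. x \<notin> K \<longrightarrow> u x = 0"
proof
  show "\<forall>k. C_k_on k UNIV u" using assms by (simp add: C0_inf_def C_k_on_UNIV)
  show "compact (closure (support_on UNIV u))" "closure (support_on UNIV u) \<subseteq> \<Omega>"
    using assms by (simp_all add: C0_inf_def)
  show "\<forall>x. x \<notin> closure (support_on UNIV u) \<longrightarrow> u x = 0"
    using closure_subset[of "support_on UNIV u"] by (auto simp: support_on_def)
qed

text \<open>For t = \<open>\<beta>\<close> / n the power map x ->
  \<open>norm x powr (t - 1) *\<^sub>R x\<close> has Jacobian
  \<open>t * norm x powr (\<beta> - n)\<close>. It turns the claim into finiteness of the volume of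
  a punctured ball.\<close>

lemma set_integrable_norm_powr:
  assumes "\<beta> > 0" "r > 0"
  shows "set_integrable lborel (ball (0::real^'n) r - {0}) (\<lambda>x. norm x powr (\<beta> - real CARD('n)))"
proof -
  define t where "t = \<beta> / real CARD('n)"
  have t: "t > 0" using assms by (simp add: t_def)
  let ?U = "ball (0::real^'n) r - {0}" and ?V = "ball (0::real^'n) (r powr t) - {0}"
  let ?m = "\<lambda>\<rho>::real. \<rho> powr (t - 1)" and ?m' = "\<lambda>\<rho>::real. (t - 1) * \<rho> powr (t - 1 - 1)"
  have nm: "norm (?m (norm x) *\<^sub>R x) = norm x powr t" for x :: "real^'n"
    by (simp add: powr_diff)
  have J: "?m (norm x) ^ (CARD('n) - 1) * (?m (norm x) + norm x * ?m' (norm x))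
      = t * norm x powr (\<beta> - real CARD('n))" if "x \<noteq> 0" for x :: "real^'n"
  proof -
    have "?m (norm x) + norm x * ?m' (norm x) = t * ?m (norm x)"
      using that by (simp add: powr_diff field_simps power2_eq_square)
    moreover have "?m (norm x) ^ (CARD('n) - 1) * (t * ?m (norm x)) = t * ?m (norm x) ^ CARD('n)"
      using power_minus_mult[of "CARD('n)" "?m (norm x)"] by (simp add: mult_ac)
    moreover have "?m (norm x) ^ CARD('n) = norm x powr (\<beta> - real CARD('n))"
    proof -
      have "(t - 1) * real CARD('n) = \<beta> - real CARD('n)" by (simp add: t_def left_diff_distrib)
      then show ?thesis using that by (simp add: powr_realpow[symmetric] powr_powr)
    qed
    ultimately show ?thesis by simp
  qed
  have inj: "inj_on (\<lambda>x. ?m (norm x) *\<^sub>R x) ?U"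
  proof (rule inj_onI)
    fix x y :: "real^'n" assume xy: "x \<in> ?U" "y \<in> ?U" "?m (norm x) *\<^sub>R x = ?m (norm y) *\<^sub>R y"
    then have "norm x powr t = norm y powr t" unfolding nm[symmetric] by simp
    then have "(norm x powr t) powr (1 / t) = (norm y powr t) powr (1 / t)" by simp
    then have "norm x = norm y" using t by (simp add: powr_powr)
    with xy show "x = y" by simp
  qed
  have img: "(\<lambda>x. ?m (norm x) *\<^sub>R x) ` ?U = ?V"
  proof (intro equalityI image_subsetI subsetI)
    fix x assume "x \<in> ?U"
    then show "?m (norm x) *\<^sub>R x \<in> ?V"
      using t nm[of x] powr_less_mono2[of t "norm x" r] by auto
  next
    fix y assume y: "y \<in> ?V"
    define x where "x = norm y powr (1 / t - 1) *\<^sub>R y"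
    have nx: "norm x = norm y powr (1 / t)" by (simp add: x_def powr_diff)
    have "norm x < r"
      using y t powr_less_mono2[of "1 / t" "norm y" "r powr t"] assms by (simp add: nx powr_powr)
    moreover have "?m (norm x) *\<^sub>R x = y"
    proof -
      have "?m (norm x) *\<^sub>R x = norm y powr (1 / t * (t - 1) + (1 / t - 1)) *\<^sub>R y"
        unfolding nx unfolding x_def powr_powr powr_add scaleR_scaleR ..
      also have "1 / t * (t - 1) + (1 / t - 1) = 0" using t by (simp add: field_simps)
      finally show ?thesis using y by simp
    qed
    ultimately show "y \<in> (\<lambda>x. ?m (norm x) *\<^sub>R x) ` ?U"
      using y by (intro image_eqI[of _ _ x]) (auto simp: x_def)
  qed
  have op: "open ?U" "0 \<notin> ?U" "open ?V" by auto
  have der: "(?m has_real_derivative ?m' (norm x)) (at (norm x))" if "x \<in> ?U" for x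
    using that by (intro has_real_derivative_powr) auto
  have cJ: "continuous_on ?U (\<lambda>x. ?m (norm x) ^ (CARD('n) - 1) * (?m (norm x) + norm x * ?m' (norm x)))"
    by (intro continuous_intros) auto
  have J0: "0 \<le> ?m (norm x) ^ (CARD('n) - 1) * (?m (norm x) + norm x * ?m' (norm x))" if "x \<in> ?U" for x
    using that t by (subst J) auto
  have fin: "set_integrable lborel ?V (\<lambda>y. 1 :: real)"
  proof -
    have "emeasure lborel ?V < \<infinity>"
      by (intro emeasure_bounded_finite bounded_subset[OF bounded_ball]) auto
    then show ?thesis unfolding set_integrable_def by (simp add: integrable_real_indicator)
  qed
  have "set_integrable lborel ?U (\<lambda>x. ?m (norm x) ^ (CARD('n) - 1) * (?m (norm x) + norm x * ?m' (norm x)) * 1)"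
    using radial_change_of_variables(1)[OF op inj img der cJ J0 continuous_on_const, of 1] fin by simp
  also have "?this \<longleftrightarrow> set_integrable lborel ?U (\<lambda>x. t * norm x powr (\<beta> - real CARD('n)))"
    by (intro set_integrable_cong refl) (use J in auto)
  finally show ?thesis using t by simp
qed

section \<open>Radial cutoffs near the origin\<close>

lemma C_k_on_inner_self: "open U \<Longrightarrow> C_k_on k U (\<lambda>x. inner x x)"
  unfolding inner_vec_def inner_real_def
  by (intro C_k_on_sum C_k_on_mult C_k_on_component finite)

text \<open>It vanishes for |x|^2 at most 1 / (j + 1). It never reaches the value 1 and only tends
  to it off the origin as j grows, which is enough for dominated convergence.\<close>

definition cutoff :: "nat \<Rightarrow> real^'n \<Rightarrow> real" where
  "cutoff j x = flat (real (Suc j) * inner x x - 1)"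

lemma C_k_on_cutoff: "C_k_on k UNIV (cutoff j)"
proof -
  have "C_k_on k UNIV (\<lambda>x::real^'a. real (Suc j) * inner x x + (- 1))"
    by (intro C_k_on_add C_k_on_mult C_k_on_const C_k_on_inner_self open_UNIV)
  then show ?thesis unfolding cutoff_def[abs_def] by (intro C_k_on_flat open_UNIV) simp
qed

lemma GDERIV_cutoff:
  "GDERIV (cutoff j) x :> (2 * real (Suc j) * flat_deriv (Suc 0) (real (Suc j) * inner x x - 1)) *\<^sub>R x"
proof -
  have "GDERIV (\<lambda>x. real (Suc j) * inner x x - 1) x :> (2 * real (Suc j)) *\<^sub>R x"
    unfolding gderiv_def
    by (auto intro!: derivative_eq_intros simp: inner_commute fun_eq_iff)
  from GDERIV_DERIV_compose[OF this DERIV_flat_deriv[of 0]] show ?thesis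
    by (simp add: cutoff_def[abs_def] flat_deriv_0 mult.commute)
qed

lemma flat_nonneg: "0 \<le> flat t" and flat_le_1: "flat t \<le> 1"
  by (simp_all add: flat_def)

lemma flat_deriv_1: "t > 0 \<Longrightarrow> flat_deriv (Suc 0) t = (1 / t)\<^sup>2 * exp (- 1 / t)"
  by (simp add: flat_deriv_def poly_monom)

text \<open>For t the argument of \<open>flat\<close> in \<open>cutoff\<close>, t + 1 is (j + 1)
  |x|^2, so twice this quantity is |x| times the radial derivative of the cutoff; this gives the
  bound 6 used below, uniformly in j. With z = 1/t the claim is z + z^2 \<le> 3 exp z.\<close>

lemma flat_deriv_1_bound: "\<bar>(t + 1) * flat_deriv (Suc 0) t\<bar> \<le> 3"
proof (cases "t > 0")
  case True
  define z where "z = 1 / t"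
  have z: "z > 0" using True by (simp add: z_def)
  have eq: "(t + 1) * flat_deriv (Suc 0) t = (z + z\<^sup>2) * exp (- z)"
    using True by (simp add: flat_deriv_1 z_def field_simps power2_eq_square)
  have "z + z\<^sup>2 \<le> 3 * exp z"
    using exp_lower_Taylor_quadratic[of z] z zero_le_power2[of z] by linarith
  then show ?thesis
    unfolding eq using z by (simp add: exp_minus divide_simps abs_mult)
qed (simp add: flat_deriv_def)

lemma flat_tendsto: "(flat \<longlongrightarrow> 1) at_top"
proof (rule Lim_transform_eventually)
  show "((\<lambda>t::real. exp (- 1 / t)) \<longlongrightarrow> 1) at_top" by real_asymp
  show "\<forall>\<^sub>F t in at_top. exp (- 1 / t) = flat t"
    using eventually_gt_at_top[of 0] by eventually_elim (simp add: flat_def)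
qed

lemma flat_deriv_1_tendsto: "((\<lambda>t. (t + 1) * flat_deriv (Suc 0) t) \<longlongrightarrow> 0) at_top"
proof (rule Lim_transform_eventually)
  show "((\<lambda>t::real. (t + 1) * ((1 / t)\<^sup>2 * exp (- 1 / t))) \<longlongrightarrow> 0) at_top" by real_asymp
  show "\<forall>\<^sub>F t in at_top. (t + 1) * ((1 / t)\<^sup>2 * exp (- 1 / t)) = (t + 1) * flat_deriv (Suc 0) t"
    using eventually_gt_at_top[of 0] by eventually_elim (simp add: flat_deriv_1)
qed

lemma cutoff_argument_tendsto:
  fixes x :: "real^'n"
  assumes "x \<noteq> 0"
  shows "filterlim (\<lambda>j. real (Suc j) * inner x x - 1) at_top sequentially"
proof -
  have "inner x x > 0" using assms by simp
  then show ?thesis by real_asymp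
qed

lemma cutoff_tendsto: "x \<noteq> 0 \<Longrightarrow> (\<lambda>j. cutoff j x) \<longlonglongrightarrow> 1"
  unfolding cutoff_def by (rule filterlim_compose[OF flat_tendsto cutoff_argument_tendsto])

lemma cutoff_deriv_bound:
  "\<bar>2 * real (Suc j) * flat_deriv (Suc 0) (real (Suc j) * inner x x - 1)\<bar> * (norm x)\<^sup>2 \<le> 6"
  using flat_deriv_1_bound[of "real (Suc j) * inner x x - 1"]
  by (simp add: abs_mult power2_norm_eq_inner mult_ac del: of_nat_Suc)

lemma cutoff_deriv_tendsto:
  fixes x :: "real^'n"
  assumes "x \<noteq> 0"
  shows "(\<lambda>j. 2 * real (Suc j) * flat_deriv (Suc 0) (real (Suc j) * inner x x - 1)) \<longlonglongrightarrow> 0"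
proof -
  \<comment> \<open>The coefficient is rewritten as 2 / |x|^2 times (t + 1) flat'(t), with t the
    argument of the cutoff, because only this product has a known limit as t tends to
    infinity.\<close>
  have "(\<lambda>j. 2 / inner x x * ((real (Suc j) * inner x x - 1 + 1) * flat_deriv (Suc 0) (real (Suc j) * inner x x - 1))) \<longlonglongrightarrow> 2 / inner x x * 0"
    by (intro tendsto_mult tendsto_const filterlim_compose[OF flat_deriv_1_tendsto cutoff_argument_tendsto[OF assms]])
  moreover have "2 / inner x x * ((s * inner x x - 1 + 1) * D) = 2 * s * D" for s D
    using assms by simp
  ultimately show ?thesis by (simp only: mult_zero_right)
qed

lemma cutoff_eq_0: "real (Suc j) * inner x x \<le> 1 \<Longrightarrow> cutoff j x = 0"
  by (simp add: cutoff_def flat_def)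

lemma grad_eq_0_off_compact:
  assumes "compact K" "\<And>x. x \<notin> K \<Longrightarrow> u x = 0" "x \<notin> K"
  shows "grad u x = 0"
proof -
  have "GDERIV (\<lambda>x. 0) x :> 0" by (rule GDERIV_const)
  then have "GDERIV u x :> 0"
    by (rule GDERIV_transform_open[where U="- K"]) (use assms compact_imp_closed in \<open>auto simp: open_Compl\<close>)
  then show ?thesis by (rule GDERIV_imp_grad(2))
qed

text \<open>The constant \<open>1\<close> satisfies this as well, so one dominating function serves \<open>u\<close> and all its cutoffs.\<close>

definition cutoff_like :: "(real^'n \<Rightarrow> real) \<Rightarrow> (real^'n \<Rightarrow> real) \<Rightarrow> bool" where
  "cutoff_like \<phi> t \<longleftrightarrow> (\<forall>x. x \<noteq> 0 \<longrightarrow>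
    0 \<le> \<phi> x \<and> \<phi> x \<le> 1 \<and> GDERIV \<phi> x :> t x *\<^sub>R x \<and> \<bar>t x\<bar> * (norm x)\<^sup>2 \<le> 6)"

lemma cutoff_like_1: "cutoff_like (\<lambda>x. 1) (\<lambda>x. 0)"
  by (simp add: cutoff_like_def GDERIV_const)

lemma cutoff_like_cutoff:
  "cutoff_like (cutoff j) (\<lambda>x. 2 * real (Suc j) * flat_deriv (Suc 0) (real (Suc j) * inner x x - 1))"
  unfolding cutoff_like_def
proof (intro allI impI conjI)
  show "0 \<le> cutoff j x" "cutoff j x \<le> 1" for x :: "real^'n"
    by (simp_all add: cutoff_def flat_nonneg flat_le_1)
qed (rule GDERIV_cutoff cutoff_deriv_bound)+

lemma compact_abs_bounded:
  fixes f :: "'a::topological_space \<Rightarrow> real"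
  assumes "compact K" "continuous_on K f"
  obtains M where "M \<ge> 0" "\<forall>x\<in>K. \<bar>f x\<bar> \<le> M"
proof -
  obtain B where "\<forall>y\<in>f ` K. norm y \<le> B"
    using compact_imp_bounded[OF compact_continuous_image[OF assms(2,1)]] unfolding bounded_iff by blast
  then have "\<forall>x\<in>K. \<bar>f x\<bar> \<le> \<bar>B\<bar>" by auto
  then show ?thesis by (rule that[OF abs_ge_zero])
qed

context ckn begin

lemma field_eq_0: "grad u x = 0 \<Longrightarrow> field c u x = 0"
  by (simp add: field_def grad_S_def grad_r_def)

text \<open>The gradient of a radial factor has no tangential part, so the extra term of the product
  rule meets neither \<open>\<delta>\<close> nor the weight.\<close>

lemma field_mult_radial:
  assumes "u differentiable (at x)" "GDERIV \<phi> x :> t *\<^sub>R x" "x \<noteq> 0"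
  shows "field c (\<lambda>x. \<phi> x * u x) x = \<phi> x *\<^sub>R field c u x + (u x * t) *\<^sub>R x"
proof -
  have g: "grad (\<lambda>x. \<phi> x * u x) x = \<phi> x *\<^sub>R grad u x + (u x * t) *\<^sub>R x"
    using GDERIV_imp_grad(2)[OF GDERIV_mult[OF assms(2) differentiable_GDERIV_grad[OF assms(1)]]] by simp
  have "inner (x /\<^sub>R norm x) x = norm x"
    using assms(3) by (simp add: power2_norm_eq_inner[symmetric] power2_eq_square)
  then have ex: "inner (x /\<^sub>R norm x) x *\<^sub>R (x /\<^sub>R norm x) = x"
    using assms(3) by simp
  have r: "grad_r (\<lambda>x. \<phi> x * u x) x = \<phi> x *\<^sub>R grad_r u x + (u x * t) *\<^sub>R x"
    unfolding grad_r_def g inner_add_right inner_scaleR_right[of _ "\<phi> x"] inner_scaleR_right[of _ "u x * t"]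
      scaleR_add_left scaleR_scaleR[symmetric, of "\<phi> x"] scaleR_scaleR[symmetric, of "u x * t"] ex ..
  then show ?thesis
    unfolding field_def grad_S_def g r by (simp add: algebra_simps)
qed

lemma measurable_Fint:
  assumes "continuous_on (dom c - {0}) u"
  shows "(\<lambda>x. indicator (dom c) x *\<^sub>R Fint c u x) \<in> borel_measurable lborel"
proof -
  have "(\<lambda>x. indicator (dom c - {0}) x *\<^sub>R Fint c u x) \<in> borel_measurable lborel"
    using borel_measurable_continuous_on_indicator[OF borel_open[OF open_punctured_dom] continuous_on_Fint[OF assms]] by simp
  also have "(\<lambda>x. indicator (dom c - {0}) x *\<^sub>R Fint c u x) = (\<lambda>x. indicator (dom c) x *\<^sub>R Fint c u x)"
    by (auto simp: fun_eq_iff indicator_def)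
  finally show ?thesis .
qed

lemma measurable_Gint:
  assumes "C_k_on (Suc 0) (dom c - {0}) u"
  shows "(\<lambda>x. indicator (dom c) x *\<^sub>R Gint c u x) \<in> borel_measurable lborel"
proof -
  have "(\<lambda>x. indicator (dom c - {0}) x *\<^sub>R Gint c u x) \<in> borel_measurable lborel"
    using borel_measurable_continuous_on_indicator[OF borel_open[OF open_punctured_dom] continuous_on_Gint[OF assms]] by simp
  also have "(\<lambda>x. indicator (dom c - {0}) x *\<^sub>R Gint c u x) = (\<lambda>x. indicator (dom c) x *\<^sub>R Gint c u x)"
    by (auto simp: fun_eq_iff indicator_def)
  finally show ?thesis .
qed

lemma norm_field_le:
  assumes "wt c x > 0"
  shows "norm (field c u x) \<le> (2 * \<bar>\<delta>\<bar> / wt c x + 1) * norm (grad u x)"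
proof -
  define e where "e = x /\<^sub>R norm x"
  have e: "norm e \<le> 1" unfolding e_def by (cases "x = 0") simp_all
  have "\<bar>inner e (grad u x)\<bar> \<le> norm e * norm (grad u x)"
    by (rule Cauchy_Schwarz_ineq2)
  also have "\<dots> \<le> 1 * norm (grad u x)"
    using e by (intro mult_right_mono) auto
  finally have "\<bar>inner e (grad u x)\<bar> * norm e \<le> norm (grad u x) * 1"
    using e by (intro mult_mono) auto
  then have r: "norm (grad_r u x) \<le> norm (grad u x)"
    unfolding grad_r_def e_def[symmetric] by simp
  then have "norm (grad_S u x) \<le> 2 * norm (grad u x)"
    unfolding grad_S_def using norm_triangle_ineq4[of "grad u x" "grad_r u x"] by simp
  then have "norm ((\<delta> / wt c x) *\<^sub>R grad_S u x) \<le> \<bar>\<delta>\<bar> / wt c x * (2 * norm (grad u x))"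
    using assms by (simp add: divide_right_mono mult_left_mono)
  with r show ?thesis
    unfolding field_def using norm_triangle_ineq[of "(\<delta> / wt c x) *\<^sub>R grad_S u x" "grad_r u x"]
    by (simp add: algebra_simps)
qed

text \<open>The dominating functions are multiples of |x|^(a\<sigma> - n) and |x|^(a\<theta> - n) on
  a punctured ball containing the rest of the support. For \<open>Gint\<close> the weight |x|^((a +
  1)\<theta>) is split so that |x|^\<theta> joins the field, since |x| times the field stays bounded
  even where the gradient of the cutoff blows up.\<close>

lemma integrands_dominated:
  fixes u :: "real^'n \<Rightarrow> real"
  assumes "u \<in> C0_inf (dom c)"
  obtains f g :: "real^'n \<Rightarrow> real" where "integrable lborel f" "integrable lborel g"
    "\<forall>\<phi> t x. cutoff_like \<phi> t \<longrightarrow> x \<in> dom c \<longrightarrow>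
      Fint c (\<lambda>x. \<phi> x * u x) x \<le> f x \<and> Gint c (\<lambda>x. \<phi> x * u x) x \<le> g x"
proof -
  from assms obtain K where "\<forall>k. C_k_on k UNIV u" and K: "compact K" "K \<subseteq> dom c"
    and "\<forall>x. x \<notin> K \<longrightarrow> u x = 0" by (rule C0_infE)
  then have u: "C_k_on k UNIV u" and u0: "x \<notin> K \<Longrightarrow> u x = 0" for k x by simp_all
  obtain r where r: "r > 0" "K \<subseteq> ball 0 r"
    using compact_imp_bounded[OF K(1)] bounded_subset_ballD by blast
  have "continuous_on K u"
    using C_k_on_imp_continuous_on[OF u[of 0]] by (rule continuous_on_subset) simp
  then obtain M where "M \<ge> 0" "\<forall>x\<in>K. \<bar>u x\<bar> \<le> M"
    using compact_abs_bounded[OF K(1)] by blast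
  then have M: "M \<ge> 0" "x \<in> K \<Longrightarrow> \<bar>u x\<bar> \<le> M" for x by simp_all
  obtain w where w: "w > 0" "\<And>x. x \<in> K \<Longrightarrow> w \<le> wt c x"
  \<comment> \<open>For negative \<open>c\<close> the weight tends to 0 at the boundary of the
    domain; compactness of the support keeps it away from 0.\<close>
  proof (cases "K = {}")
    case True then show ?thesis using that[of 1] by simp
  next
    case False
    obtain x0 where "x0 \<in> K" "\<forall>x\<in>K. wt c x0 \<le> wt c x"
      using continuous_attains_inf[OF K(1) False continuous_on_wt] by blast
    with K(2) show ?thesis by (intro that[of "wt c x0"]) (auto simp: dom_def)
  qed
  have "continuous_on K (grad u)"
    using continuous_on_grad[OF u[of "Suc 0"]] by (rule continuous_on_subset) simp
  then obtain D where "D \<ge> 0" "\<forall>x\<in>K. \<bar>norm (grad u x)\<bar> \<le> D"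
    using compact_abs_bounded[OF K(1) continuous_on_norm] by blast
  then have D: "D \<ge> 0" "x \<in> K \<Longrightarrow> norm (grad u x) \<le> D" for x by simp_all
  \<comment> \<open>The first summand bounds |x| times the field of \<open>u\<close>; the second
    bounds |u| times |x| times the gradient of the cutoff, with the 6 from
    \<open>cutoff_like\<close>.\<close>
  define C where "C = (2 * \<bar>\<delta>\<bar> / w + 1) * D * r + 6 * M"
  have C: "C \<ge> 0" using w D r M by (simp add: C_def)
  define E where "E = 1 + (\<theta> - 1) / \<theta> * \<sigma>"
  have E: "E > 0" using \<theta>_gt_1 \<sigma>_pos by (simp add: E_def add_pos_pos)
  define A where "A = M powr \<sigma> / w powr E"
  let ?B = "ball (0::real^'n) r - {0}" and ?N = "real CARD('n)"
  define f where "f x = indicator ?B x *\<^sub>R (A * norm x powr (a * \<sigma> - ?N))" for x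
  define g where "g x = indicator ?B x *\<^sub>R (C powr \<theta> * norm x powr (a * \<theta> - ?N))" for x
  have fg: "integrable lborel f" "integrable lborel g"
    using set_integrable_norm_powr[OF _ r(1), of "a * \<sigma>", where 'n='n]
      set_integrable_norm_powr[OF _ r(1), of "a * \<theta>", where 'n='n] a_pos \<sigma>_pos \<theta>_gt_1
    unfolding f_def g_def set_integrable_def[symmetric] by (auto intro: set_integrable_mult_right)
  have bound: "Fint c (\<lambda>x. \<phi> x * u x) x \<le> f x \<and> Gint c (\<lambda>x. \<phi> x * u x) x \<le> g x"
    if "cutoff_like \<phi> t" and x: "x \<in> dom c" for \<phi> t x
  proof (cases "x \<in> K \<and> x \<noteq> 0")
    case True
    then have \<phi>: "0 \<le> \<phi> x" "\<phi> x \<le> 1" and t: "GDERIV \<phi> x :> t x *\<^sub>R x" "\<bar>t x\<bar> * (norm x)\<^sup>2 \<le> 6"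
      using that(1) by (simp_all add: cutoff_like_def)
    from True have xB: "x \<in> ?B" and x0: "norm x > 0" using r by auto
    have W: "w \<le> wt c x" "wt c x > 0" using True w K by (auto simp: dom_def)
    have pw: "norm x powr (\<beta> - ?N) = norm x powr \<beta> / norm x ^ CARD('n)" for \<beta>
      using x0 by (simp add: powr_diff powr_realpow)
    have "\<bar>\<phi> x * u x\<bar> \<le> 1 * M"
      unfolding abs_mult using \<phi> M(2)[of x] True by (intro mult_mono) auto
    then have "\<bar>\<phi> x * u x\<bar> powr \<sigma> / wt c x powr E \<le> A"
      unfolding A_def using W w \<sigma>_pos E by (intro frac_le powr_mono2) auto
    then have "norm x powr (a * \<sigma>) / norm x ^ CARD('n) * (\<bar>\<phi> x * u x\<bar> powr \<sigma> / wt c x powr E)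
        \<le> norm x powr (a * \<sigma>) / norm x ^ CARD('n) * A"
      by (intro mult_left_mono) auto
    then have 1: "Fint c (\<lambda>x. \<phi> x * u x) x \<le> f x"
      using xB by (simp add: Fint_def f_def pw E_def mult_ac)
    have "norm (field c u x) \<le> (2 * \<bar>\<delta>\<bar> / w + 1) * D"
    proof -
      have "(2 * \<bar>\<delta>\<bar> / wt c x + 1) * norm (grad u x) \<le> (2 * \<bar>\<delta>\<bar> / w + 1) * D"
        using W w D True by (intro mult_mono add_mono divide_left_mono) auto
      with norm_field_le[OF W(2), of u] show ?thesis by linarith
    qed
    then have "norm (field c u x) * norm x \<le> (2 * \<bar>\<delta>\<bar> / w + 1) * D * r"
      using xB D w by (intro mult_mono) auto
    moreover have "\<phi> x * (norm (field c u x) * norm x) \<le> 1 * (norm (field c u x) * norm x)"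
      using \<phi> True by (intro mult_right_mono) auto
    moreover have "\<bar>u x\<bar> * (\<bar>t x\<bar> * (norm x)\<^sup>2) \<le> M * 6"
      using t True M by (intro mult_mono) auto
    ultimately have "\<phi> x * (norm (field c u x) * norm x) + \<bar>u x\<bar> * (\<bar>t x\<bar> * (norm x)\<^sup>2) \<le> C"
      unfolding C_def by linarith
    moreover have "norm (field c (\<lambda>x. \<phi> x * u x) x) * norm x
        \<le> \<phi> x * (norm (field c u x) * norm x) + \<bar>u x\<bar> * (\<bar>t x\<bar> * (norm x)\<^sup>2)"
    proof -
      have "u differentiable (at x)" using u[of "Suc 0"] by simp
      then have "field c (\<lambda>x. \<phi> x * u x) x = \<phi> x *\<^sub>R field c u x + (u x * t x) *\<^sub>R x"
        using t True by (intro field_mult_radial) auto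
      then have "norm (field c (\<lambda>x. \<phi> x * u x) x) \<le> \<phi> x * norm (field c u x) + \<bar>u x\<bar> * \<bar>t x\<bar> * norm x"
        using norm_triangle_ineq[of "\<phi> x *\<^sub>R field c u x" "(u x * t x) *\<^sub>R x"] \<phi> True
        by (simp add: abs_mult)
      from mult_right_mono[OF this norm_ge_zero[of x]] show ?thesis
        by (simp add: algebra_simps power2_eq_square)
    qed
    ultimately have "norm (field c (\<lambda>x. \<phi> x * u x) x) * norm x \<le> C" by linarith
    then have "norm (field c (\<lambda>x. \<phi> x * u x) x) powr \<theta> * norm x powr \<theta> \<le> C powr \<theta>"
      using \<theta>_gt_1 powr_mono2[of \<theta> "norm (field c (\<lambda>x. \<phi> x * u x) x) * norm x" C] by (simp add: powr_mult)
    then have "norm x powr (a * \<theta>) / norm x ^ CARD('n) * (norm (field c (\<lambda>x. \<phi> x * u x) x) powr \<theta> * norm x powr \<theta>)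
        \<le> norm x powr (a * \<theta>) / norm x ^ CARD('n) * C powr \<theta>"
      by (intro mult_left_mono) auto
    also have "\<dots> = g x"
      using xB by (simp add: g_def pw)
    also have "norm x powr (a * \<theta>) / norm x ^ CARD('n) * (norm (field c (\<lambda>x. \<phi> x * u x) x) powr \<theta> * norm x powr \<theta>)
        = Gint c (\<lambda>x. \<phi> x * u x) x"
      unfolding Gint_def distrib_right powr_add by simp
    finally have "Gint c (\<lambda>x. \<phi> x * u x) x \<le> g x" .
    with 1 show ?thesis by simp
  next
    case False
    have "Fint c (\<lambda>x. \<phi> x * u x) x = 0 \<and> Gint c (\<lambda>x. \<phi> x * u x) x = 0"
    proof (cases "x = 0")
      case x0: False
      with False have xK: "x \<notin> K" by simp
      have "grad (\<lambda>x. \<phi> x * u x) x = 0"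
        by (rule grad_eq_0_off_compact[OF K(1) _ xK]) (simp add: u0)
      then show ?thesis using xK u0 \<theta>_gt_1 \<sigma>_pos by (simp add: Fint_def Gint_def field_eq_0)
    qed simp
    moreover have "0 \<le> f x" "0 \<le> g x" using w by (simp_all add: f_def g_def A_def)
    ultimately show ?thesis by simp
  qed
  show ?thesis by (rule that[OF fg]) (intro allI impI bound)
qed

lemma C0_inf_imp_C_k_on: "u \<in> C0_inf \<Omega> \<Longrightarrow> C_k_on k U u"
  using C_k_on_subset[of k UNIV u U] by (simp add: C0_inf_def C_k_on_UNIV)

lemma integrable_F_G:
  assumes "u \<in> C0_inf (dom c)"
  shows "set_integrable lborel (dom c) (Fint c u)" "set_integrable lborel (dom c) (Gint c u)"
proof -
  obtain f g where fg: "integrable lborel f" "integrable lborel g"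
    and "\<forall>\<phi> t x. cutoff_like \<phi> t \<longrightarrow> x \<in> dom c \<longrightarrow>
      Fint c (\<lambda>x. \<phi> x * u x) x \<le> f x \<and> Gint c (\<lambda>x. \<phi> x * u x) x \<le> g x"
    using assms by (rule integrands_dominated)
  then have b: "Fint c (\<lambda>x. \<phi> x * u x) x \<le> f x \<and> Gint c (\<lambda>x. \<phi> x * u x) x \<le> g x"
    if "x \<in> dom c" "cutoff_like \<phi> t" for \<phi> t x using that by blast
  have bb: "Fint c u x \<le> f x \<and> Gint c u x \<le> g x" if "x \<in> dom c" for x
    using b[OF that cutoff_like_1] by simp
  note C1 = C0_inf_imp_C_k_on[OF assms]
  show "set_integrable lborel (dom c) (Fint c u)"
    unfolding set_integrable_def
  proof (rule Bochner_Integration.integrable_bound[OF fg(1) measurable_Fint])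
    show "continuous_on (dom c - {0}) u" by (rule C_k_on_imp_continuous_on[OF C1])
    show "AE x in lborel. norm (indicator (dom c) x *\<^sub>R Fint c u x) \<le> norm (f x)"
    proof (rule AE_I2)
      fix x show "norm (indicator (dom c) x *\<^sub>R Fint c u x) \<le> norm (f x)"
        using bb[of x] Fint_nonneg[of c "u" x] by (cases "x \<in> dom c") auto
    qed
  qed
  show "set_integrable lborel (dom c) (Gint c u)"
    unfolding set_integrable_def
  proof (rule Bochner_Integration.integrable_bound[OF fg(2) measurable_Gint])
    show "C_k_on (Suc 0) (dom c - {0}) u" by (rule C1)
    show "AE x in lborel. norm (indicator (dom c) x *\<^sub>R Gint c u x) \<le> norm (g x)"
    proof (rule AE_I2)
      fix x show "norm (indicator (dom c) x *\<^sub>R Gint c u x) \<le> norm (g x)"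
        using bb[of x] Gint_nonneg[of c "u" x] by (cases "x \<in> dom c") auto
    qed
  qed
qed

text \<open>Dominated convergence with a bound independent of \<open>j\<close>. Off the origin the
  cutoff tends to 1 and its gradient to 0, so the fields converge pointwise; at the origin the
  integrands are 0.\<close>

lemma cutoff_approximation:
  fixes u :: "real^'n \<Rightarrow> real"
  assumes "u \<in> C0_inf (dom c)"
  shows "(\<lambda>j. F c (\<lambda>x. cutoff j x * u x)) \<longlonglongrightarrow> F c u"
    and "(\<lambda>j. G c (\<lambda>x. cutoff j x * u x)) \<longlonglongrightarrow> G c u"
proof -
  define v where "v j = (\<lambda>x. cutoff j x * u x)" for j
  obtain f g where fg: "integrable lborel f" "integrable lborel g"
    and "\<forall>\<phi> t x. cutoff_like \<phi> t \<longrightarrow> x \<in> dom c \<longrightarrow>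
      Fint c (\<lambda>x. \<phi> x * u x) x \<le> f x \<and> Gint c (\<lambda>x. \<phi> x * u x) x \<le> g x"
    using assms by (rule integrands_dominated)
  then have b: "Fint c (\<lambda>x. \<phi> x * u x) x \<le> f x \<and> Gint c (\<lambda>x. \<phi> x * u x) x \<le> g x"
    if "x \<in> dom c" "cutoff_like \<phi> t" for \<phi> t x using that by blast
  let ?t = "\<lambda>j x. 2 * real (Suc j) * flat_deriv (Suc 0) (real (Suc j) * inner x x - 1)"
  have bb: "Fint c (v j) x \<le> f x \<and> Gint c (v j) x \<le> g x" if "x \<in> dom c" for x j
    unfolding v_def by (rule b[OF that cutoff_like_cutoff])
  have C1: "C_k_on k U (v j)" for k U j
    unfolding v_def by (rule C_k_on_subset[OF C_k_on_mult[OF open_UNIV C_k_on_cutoff C0_inf_imp_C_k_on[OF assms]]]) simp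
  have C1u: "C_k_on k U u" for k U by (rule C0_inf_imp_C_k_on[OF assms])
  have vt: "(\<lambda>j. v j x) \<longlonglongrightarrow> u x" if "x \<noteq> 0" for x
    unfolding v_def using tendsto_mult[OF cutoff_tendsto[OF that] tendsto_const[of "u x"]] by simp
  have ft: "(\<lambda>j. field c (v j) x) \<longlonglongrightarrow> field c u x" if "x \<noteq> 0" for x
  proof -
    have "field c (v j) x = cutoff j x *\<^sub>R field c u x + (u x * ?t j x) *\<^sub>R x" for j
      unfolding v_def using C1u[of "Suc 0" UNIV] that by (intro field_mult_radial GDERIV_cutoff) simp_all
    moreover have "(\<lambda>j. cutoff j x *\<^sub>R field c u x + (u x * ?t j x) *\<^sub>R x)
        \<longlonglongrightarrow> 1 *\<^sub>R field c u x + (u x * 0) *\<^sub>R x"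
      by (intro tendsto_add tendsto_scaleR tendsto_mult tendsto_const cutoff_tendsto that cutoff_deriv_tendsto)
    ultimately show ?thesis by simp
  qed
  have "(\<lambda>j. LINT x|lborel. indicator (dom c) x *\<^sub>R Fint c (v j) x) \<longlonglongrightarrow> (LINT x|lborel. indicator (dom c) x *\<^sub>R Fint c u x)"
  proof (rule integral_dominated_convergence[where w="\<lambda>x. \<bar>f x\<bar>"])
    show "integrable lborel (\<lambda>x. \<bar>f x\<bar>)" using fg(1) by simp
    show "(\<lambda>x. indicator (dom c) x *\<^sub>R Fint c u x) \<in> borel_measurable lborel"
      by (rule measurable_Fint[OF C_k_on_imp_continuous_on[OF C1u]])
    show "(\<lambda>x. indicator (dom c) x *\<^sub>R Fint c (v j) x) \<in> borel_measurable lborel" for j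
      by (rule measurable_Fint[OF C_k_on_imp_continuous_on[OF C1]])
    show "AE x in lborel. norm (indicator (dom c) x *\<^sub>R Fint c (v j) x) \<le> \<bar>f x\<bar>" for j
    proof (rule AE_I2)
      fix x show "norm (indicator (dom c) x *\<^sub>R Fint c (v j) x) \<le> \<bar>f x\<bar>"
        using bb[of x j] Fint_nonneg[of c "(v j)" x] by (cases "x \<in> dom c") auto
    qed
    show "AE x in lborel. (\<lambda>j. indicator (dom c) x *\<^sub>R Fint c (v j) x) \<longlonglongrightarrow> indicator (dom c) x *\<^sub>R Fint c u x"
    proof (intro AE_I2 tendsto_scaleR tendsto_const)
      fix x show "(\<lambda>j. Fint c (v j) x) \<longlonglongrightarrow> Fint c u x"
      proof (cases "x = 0")
        case False
        have "(\<lambda>j. \<bar>v j x\<bar> powr \<sigma>) \<longlonglongrightarrow> \<bar>u x\<bar> powr \<sigma>"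
          using \<sigma>_pos by (intro tendsto_powr2 tendsto_rabs vt False tendsto_const) auto
        then show ?thesis unfolding Fint_def divide_inverse by (intro tendsto_mult tendsto_const)
      qed simp
    qed
  qed
  then show "(\<lambda>j. F c (\<lambda>x. cutoff j x * u x)) \<longlonglongrightarrow> F c u"
    unfolding F_def set_lebesgue_integral_def v_def .
  have "(\<lambda>j. LINT x|lborel. indicator (dom c) x *\<^sub>R Gint c (v j) x) \<longlonglongrightarrow> (LINT x|lborel. indicator (dom c) x *\<^sub>R Gint c u x)"
  proof (rule integral_dominated_convergence[where w="\<lambda>x. \<bar>g x\<bar>"])
    show "integrable lborel (\<lambda>x. \<bar>g x\<bar>)" using fg(2) by simp
    show "(\<lambda>x. indicator (dom c) x *\<^sub>R Gint c u x) \<in> borel_measurable lborel"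
      by (rule measurable_Gint[OF C1u])
    show "(\<lambda>x. indicator (dom c) x *\<^sub>R Gint c (v j) x) \<in> borel_measurable lborel" for j
      by (rule measurable_Gint[OF C1])
    show "AE x in lborel. norm (indicator (dom c) x *\<^sub>R Gint c (v j) x) \<le> \<bar>g x\<bar>" for j
    proof (rule AE_I2)
      fix x show "norm (indicator (dom c) x *\<^sub>R Gint c (v j) x) \<le> \<bar>g x\<bar>"
        using bb[of x j] Gint_nonneg[of c "(v j)" x] by (cases "x \<in> dom c") auto
    qed
    show "AE x in lborel. (\<lambda>j. indicator (dom c) x *\<^sub>R Gint c (v j) x) \<longlonglongrightarrow> indicator (dom c) x *\<^sub>R Gint c u x"
    proof (intro AE_I2 tendsto_scaleR tendsto_const)
      fix x show "(\<lambda>j. Gint c (v j) x) \<longlonglongrightarrow> Gint c u x"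
      proof (cases "x = 0")
        case False
        have "(\<lambda>j. norm (field c (v j) x) powr \<theta>) \<longlonglongrightarrow> norm (field c u x) powr \<theta>"
          using \<theta>_gt_1 by (intro tendsto_powr2 tendsto_norm ft False tendsto_const) auto
        then show ?thesis unfolding Gint_def divide_inverse by (intro tendsto_mult tendsto_const)
      qed simp
    qed
  qed
  then show "(\<lambda>j. G c (\<lambda>x. cutoff j x * u x)) \<longlonglongrightarrow> G c u"
    unfolding G_def set_lebesgue_integral_def v_def .
qed

section \<open>Transplanting test functions between weights\<close>

lemma C_k_on_radial_map:
  fixes U :: "(real^'n) set"
  assumes "open U" "0 \<notin> U" "\<And>x. x \<in> U \<Longrightarrow> l * norm x powr (- \<alpha>) + b > 0"
  shows "C_k_on k U (\<lambda>x. radial_map l b x $ i)"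
proof -
  have "C_k_on k U (\<lambda>x. (l * norm x powr (- \<alpha>) + b) powr (- (1 / \<alpha>)) * (x $ i * norm x powr (- 1)))"
    using assms
    by (intro C_k_on_mult C_k_on_powr C_k_on_add C_k_on_const C_k_on_norm_powr C_k_on_component) auto
  also have "?this \<longleftrightarrow> ?thesis"
    using assms(2) by (intro C_k_on_cong[OF assms(1)]) (auto simp: radial_map_def powr_minus mult.commute)
  finally show ?thesis .
qed

text \<open>The map with l = 1 and b = c - c' suffices to change the weight. It sends the compact
  support, which avoids the origin, to a compact set avoiding the origin, so composing with the
  inverse map and extending by 0 is smooth: the punctured domain and the complement of the new
  support are open and cover the space.\<close>

lemma transplant:
  fixes v :: "real^'n \<Rightarrow> real"
  assumes c: "c \<le> 0" "c' \<le> 0" and v: "\<And>k. C_k_on k UNIV v"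
    and K: "compact K" "K \<subseteq> dom c - {0}" "\<And>x. x \<notin> K \<Longrightarrow> v x = 0"
  obtains w :: "real^'n \<Rightarrow> real" where "w \<in> C0_inf (dom c')" "F c' w = F c v" "G c' w = G c v"
proof -
  have b1: "(c - c') + c' = 1 * c" and b2: "(c' - c) + c = 1 * c'" by simp_all
  let ?\<Phi> = "radial_map 1 (c - c') :: real^'n \<Rightarrow> real^'n"
  let ?\<Psi> = "radial_map 1 (c' - c) :: real^'n \<Rightarrow> real^'n"
  let ?U = "dom c - {0} :: (real^'n) set" and ?V = "dom c' - {0} :: (real^'n) set"
  define w where "w y = (if y \<in> ?V then v (?\<Psi> y) else 0)" for y
  have \<Psi>\<Phi>: "?\<Psi> (?\<Phi> x) = x" if "x \<in> ?U" for x
    using radial_map_inverse[OF zero_less_one c(2) b1 that] by simp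
  have \<Phi>\<Psi>: "?\<Phi> (?\<Psi> y) = y" if "y \<in> ?V" for y
    using radial_map_inverse[OF zero_less_one c(1) b2 that] by simp
  have \<Phi>V: "?\<Phi> x \<in> ?V" if "x \<in> ?U" for x
    by (rule radial_map_in_dom[OF zero_less_one c(2) b1 that])
  have "continuous_on K ?\<Phi>"
    by (rule has_derivative_continuous_on[OF has_derivative_at_withinI[OF has_derivative_radial_map[OF zero_less_one c(2,1) b1]]])
      (use K(2) in blast)
  then have K': "compact (?\<Phi> ` K)" using K(1) by (rule compact_continuous_image)
  have K'V: "?\<Phi> ` K \<subseteq> ?V" by (intro image_subsetI \<Phi>V subsetD[OF K(2)])
  have w0: "w y = 0" if "y \<notin> ?\<Phi> ` K" for y
  proof (cases "y \<in> ?V")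
    case True
    have "?\<Psi> y \<notin> K" using imageI[of "?\<Psi> y" K ?\<Phi>] that unfolding \<Phi>\<Psi>[OF True] by (rule contrapos_nn[rotated])
    then show ?thesis by (simp add: w_def K(3))
  next
    case False
    then show ?thesis unfolding w_def by (rule if_not_P)
  qed
  have wk: "C_k_on k UNIV w" for k
  proof -
    have "C_k_on k ?V (\<lambda>y. v (?\<Psi> y))"
    proof (rule C_k_on_compose[OF open_punctured_dom open_UNIV])
      show "C_k_on k ?V (\<lambda>y. ?\<Psi> y $ j)" for j
        using base_pos[OF zero_less_one c(1) b2]
        by (intro C_k_on_radial_map open_punctured_dom) auto
    qed (use v in auto)
    also have "?this \<longleftrightarrow> C_k_on k ?V w"
      by (intro C_k_on_cong[OF open_punctured_dom]) (simp add: w_def)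
    finally have 1: "C_k_on k ?V w" .
    have op: "open (- ?\<Phi> ` K)" using K' by (simp add: compact_imp_closed open_Compl)
    have "C_k_on k (- ?\<Phi> ` K) (\<lambda>y. 0)" using op by (rule C_k_on_const)
    also have "?this \<longleftrightarrow> C_k_on k (- ?\<Phi> ` K) w"
      by (intro C_k_on_cong[OF op]) (simp add: w0)
    finally have "C_k_on k (?V \<union> - ?\<Phi> ` K) w"
      using 1 op open_punctured_dom by (intro C_k_on_Un)
    moreover have "?V \<union> - ?\<Phi> ` K = UNIV" using K'V by blast
    ultimately show ?thesis by simp
  qed
  have "w \<in> C0_inf (dom c')"
    by (rule C0_infI[OF wk K' _ w0]) (use K'V in blast)
  moreover have "v x = 1 powr (- ((\<theta> - 1) / \<theta>)) * w (?\<Phi> x)" if "x \<in> ?U" for x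
    using \<Phi>V[OF that] \<Psi>\<Phi>[OF that] by (simp add: w_def)
  from F_G_pullback(2,4)[OF zero_less_one c(2,1) b1 this C_k_on_subset[OF wk subset_UNIV]]
  have "F c' w = F c v" "G c' w = G c v" by simp_all
  ultimately show ?thesis by (rule that)
qed

text \<open>A general test function cannot be transplanted because its support may contain the
  origin; its cutoffs can, and the inequality survives the limit with the same constant.\<close>

lemma inequality_transfer:
  fixes u :: "real^'n \<Rightarrow> real"
  assumes c: "c \<le> 0" "c' \<le> 0" and st: "s > 0" "t > 0"
    and ineq: "\<And>w::real^'n \<Rightarrow> real. w \<in> C0_inf (dom c') \<Longrightarrow> C * F c' w powr s \<le> G c' w powr t"
    and u: "u \<in> C0_inf (dom c)"
  shows "C * F c u powr s \<le> G c u powr t"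
proof -
  from u obtain K where "\<forall>k. C_k_on k UNIV u" and K: "compact K" "K \<subseteq> dom c"
    and "\<forall>x. x \<notin> K \<longrightarrow> u x = 0" by (rule C0_infE)
  then have uk: "C_k_on k UNIV u" and u0: "x \<notin> K \<Longrightarrow> u x = 0" for k x by simp_all
  have "C * F c (\<lambda>x. cutoff j x * u x) powr s \<le> G c (\<lambda>x. cutoff j x * u x) powr t" for j
  proof -
    \<comment> \<open>The cutoff vanishes on \<open>?O\<close>. Removing this open neighbourhood of
      0 from \<open>K\<close> leaves a compact set off the origin that still carries the
      product.\<close>
    let ?O = "{x::real^'n. real (Suc j) * inner x x < 1}"
    have "open ?O" by (intro open_Collect_less continuous_intros)
    then have K': "compact (K - ?O)" using K(1) by (rule compact_diff[rotated])
    have "0 \<in> ?O" by simp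
    then have sub: "K - ?O \<subseteq> dom c - {0}" using K(2) by blast
    have z: "cutoff j x * u x = 0" if "x \<notin> K - ?O" for x
      using that u0[of x] cutoff_eq_0[of j x] by auto
    have vk: "C_k_on k UNIV (\<lambda>x. cutoff j x * u x)" for k
      by (intro C_k_on_mult C_k_on_cutoff uk open_UNIV)
    obtain w :: "real^'n \<Rightarrow> real" where "w \<in> C0_inf (dom c')" "F c' w = F c (\<lambda>x. cutoff j x * u x)" "G c' w = G c (\<lambda>x. cutoff j x * u x)"
      using transplant[OF c vk K' sub z] .
    with ineq[of w] show ?thesis by simp
  qed
  moreover have "(\<lambda>j. C * F c (\<lambda>x. cutoff j x * u x) powr s) \<longlonglongrightarrow> C * F c u powr s"
    using st by (intro tendsto_mult tendsto_const tendsto_powr2 cutoff_approximation[OF u]) (auto simp: F_nonneg G_nonneg)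
  moreover have "(\<lambda>j. G c (\<lambda>x. cutoff j x * u x) powr t) \<longlonglongrightarrow> G c u powr t"
    using st by (intro tendsto_powr2 tendsto_const cutoff_approximation[OF u]) (auto simp: F_nonneg G_nonneg)
  ultimately show ?thesis by (intro LIMSEQ_le) blast+
qed

end

section \<open>Sharp constants and scaling\<close>

text \<open>A single function with positive left side bounds the admissible constants from above,
  and 0 is admissible, so the supremum is meaningful. Each inequality with positive left side is an
  upper bound on C, hence passes to the supremum.\<close>

lemma best_constant_iff:
  assumes "\<And>u. u \<in> X \<Longrightarrow> 0 \<le> F u" "\<And>u. u \<in> X \<Longrightarrow> 0 \<le> G u" "u\<^sub>0 \<in> X" "F u\<^sub>0 > 0"
  shows "(\<forall>u\<in>X. C * F u \<le> G u) \<longleftrightarrow> C \<le> best_constant X F G"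
proof -
  let ?A = "{C. \<forall>u\<in>X. C * F u \<le> G u}"
  have ub: "K \<le> G u / F u" if "K \<in> ?A" "u \<in> X" "F u > 0" for K u
    using that by (simp add: field_simps)
  have "bdd_above ?A"
    by (rule bdd_aboveI[of _ "G u\<^sub>0 / F u\<^sub>0"]) (rule ub[OF _ assms(3,4)])
  moreover have "0 \<in> ?A" using assms(2) by simp
  ultimately show ?thesis
  proof (intro iffI ballI)
    assume "bdd_above ?A" "\<forall>u\<in>X. C * F u \<le> G u"
    then show "C \<le> best_constant X F G"
      unfolding best_constant_def by (intro cSup_upper) simp_all
  next
    fix u assume A: "0 \<in> ?A" and C: "C \<le> best_constant X F G" and u: "u \<in> X"
    show "C * F u \<le> G u"
    proof (cases "F u = 0")
      case True then show ?thesis using assms(2)[OF u] by simp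
    next
      case False
      then have Fu: "F u > 0" using assms(1)[OF u] by simp
      have "Sup ?A \<le> G u / F u"
        by (rule cSup_least) (use A in blast, rule ub[OF _ u Fu])
      with C have "C \<le> G u / F u" unfolding best_constant_def by linarith
      then show ?thesis using Fu by (simp add: field_simps)
    qed
  qed
qed

context ckn begin

lemma wt_0 [simp]: "wt 0 x = 1"
  by (simp add: wt_def)

lemma dom_0: "dom 0 = UNIV"
  by (simp add: dom_def)

text \<open>Supplies the function that makes the supremum in \<open>best_constant\<close> finite: a
  bump supported in the closed unit ball and positive inside.\<close>

lemma ex_F_pos:
  obtains u :: "real^'n \<Rightarrow> real" where "u \<in> C0_inf UNIV" "F 0 u > 0"
proof
  define u :: "real^'n \<Rightarrow> real" where "u x = flat (1 + (- 1) * inner x x)" for x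
  have "C_k_on k UNIV u" for k
    unfolding u_def[abs_def]
    by (intro C_k_on_flat C_k_on_add C_k_on_mult C_k_on_const C_k_on_inner_self open_UNIV)
  moreover have "u x = 0" if "x \<notin> cball 0 1" for x
  proof -
    have "1 \<le> (norm x)\<^sup>2" using that one_le_power[of "norm x" 2] by simp
    then show ?thesis by (simp add: u_def flat_def power2_norm_eq_inner)
  qed
  ultimately show u: "u \<in> C0_inf UNIV"
    by (intro C0_infI[OF _ compact_cball subset_UNIV])
  have pos: "Fint 0 u x > 0" if "x \<in> ball 0 1" "x \<noteq> 0" for x
  proof -
    have "(norm x)\<^sup>2 < 1" using that(1) by (simp add: power_less_one_iff)
    then have "u x > 0" by (simp add: u_def flat_def power2_norm_eq_inner)
    then show ?thesis using that(2) by (simp add: Fint_def)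
  qed
  have "F 0 u \<noteq> 0"
  proof
    assume F: "F 0 u = 0"
    have "integrable lborel (Fint 0 u)"
      using integrable_F_G(1)[of u 0] u unfolding dom_0 set_integrable_def by simp
    moreover have "integral\<^sup>L lborel (Fint 0 u) = 0"
      using F unfolding F_def dom_0 set_lebesgue_integral_def by simp
    ultimately have "AE x in lborel. Fint 0 u x = 0"
      using integral_nonneg_eq_0_iff_AE[of lborel "Fint 0 u"] by (simp add: Fint_nonneg)
    then have "AE x in lborel. x \<notin> ball (0 :: real^'n) 1"
      using AE_lborel_singleton[of 0]
    proof eventually_elim
      case (elim x) then show ?case using pos[of x] by auto
    qed
    then have "emeasure lborel {x \<in> space lborel. x \<in> ball (0 :: real^'n) 1} = 0"
      by (intro emeasure_eq_0_AE) simp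
    moreover have "{x \<in> space lborel. x \<in> ball (0 :: real^'n) 1} = ball 0 1" by auto
    moreover have "unit_ball_vol (real CARD('n)) \<noteq> 0"
      using unit_ball_vol_pos[OF of_nat_0_le_iff, of "CARD('n)"] by (rule less_imp_neq[symmetric])
    ultimately show False
      using emeasure_ball[of 1 "0 :: real^'n"] by simp
  qed
  with F_nonneg[of 0 u] show "F 0 u > 0" by linarith
qed

text \<open>The transfer in both directions shows that weight \<open>c\<close> and weight 0 admit
  the same constants. Taking C to be the best constant gives the inequality; taking C arbitrary
  gives optimality.\<close>

lemma sharp_constant:
  fixes s t c :: real
  assumes "c \<le> 0" "s > 0" "t > 0"
  shows "(\<forall>u\<in>C0_inf (dom c :: (real^'n) set). C * F c u powr s \<le> G c u powr t) \<longleftrightarrow>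
    C \<le> best_constant (C0_inf (UNIV :: (real^'n) set)) (\<lambda>u. F 0 u powr s) (\<lambda>u. G 0 u powr t)"
proof -
  obtain u0 :: "real^'n \<Rightarrow> real" where u0: "u0 \<in> C0_inf UNIV" "F 0 u0 > 0" by (rule ex_F_pos)
  have "(\<forall>u\<in>C0_inf (dom c :: (real^'n) set). C * F c u powr s \<le> G c u powr t) \<longleftrightarrow>
      (\<forall>u\<in>C0_inf (UNIV :: (real^'n) set). C * F 0 u powr s \<le> G 0 u powr t)"
  proof (intro iffI ballI)
    fix u assume "\<forall>u\<in>C0_inf (dom c :: (real^'n) set). C * F c u powr s \<le> G c u powr t"
      and "u \<in> C0_inf (UNIV :: (real^'n) set)"
    then show "C * F 0 u powr s \<le> G 0 u powr t"
      using inequality_transfer[of 0 c s t C u] assms by (simp add: dom_0)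
  next
    fix u assume "\<forall>u\<in>C0_inf (UNIV :: (real^'n) set). C * F 0 u powr s \<le> G 0 u powr t"
      and "u \<in> C0_inf (dom c :: (real^'n) set)"
    then show "C * F c u powr s \<le> G c u powr t"
      using inequality_transfer[of c 0 s t C u] assms by (simp add: dom_0)
  qed
  also have "\<dots> \<longleftrightarrow> C \<le> best_constant (C0_inf (UNIV :: (real^'n) set)) (\<lambda>u. F 0 u powr s) (\<lambda>u. G 0 u powr t)"
    by (rule best_constant_iff[OF _ _ u0(1)]) (use u0(2) in auto)
  finally show ?thesis .
qed

text \<open>The maps with c' = c are those with b = l c - c = (1 - l) (-c), a one-parameter family
  indexed by \<open>l\<close>.\<close>

lemma scaling_invariance:
  fixes u :: "real^'n \<Rightarrow> real"
  assumes "c \<le> 0" "l > 0" "u \<in> C0_inf (dom c)"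
  defines "v \<equiv> \<lambda>x. l powr (- ((\<theta> - 1) / \<theta>)) * u (radial_map l ((1 - l) * (- c)) x)"
  shows "set_integrable lborel (dom c) (Fint c v)" "set_integrable lborel (dom c) (Gint c v)"
    "F c v = F c u" "G c v = G c u"
proof -
  have bc: "(1 - l) * (- c) + c = l * c" by (simp add: algebra_simps)
  have v: "v x = l powr (- ((\<theta> - 1) / \<theta>)) * u (radial_map l ((1 - l) * (- c)) x)" for x
    by (simp add: v_def)
  note pull = F_G_pullback[OF assms(2,1,1) bc v C0_inf_imp_C_k_on[OF assms(3)]]
  show "set_integrable lborel (dom c) (Fint c v)" "set_integrable lborel (dom c) (Gint c v)"
    "F c v = F c u" "G c v = G c u"
    unfolding pull using integrable_F_G[OF assms(3)] by simp_all
qed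

section \<open>Matching the stated integrands with the weighted ones\<close>

lemma dom_eq_ball:
  assumes "R > 0"
  shows "dom (- (R powr (- \<alpha>))) = ball (0 :: real^'n) R"
proof -
  have wt_pos: "wt (- (R powr (- \<alpha>))) x > 0 \<longleftrightarrow> norm x < R" for x :: "real^'n"
  proof -
    have "wt (- (R powr (- \<alpha>))) x > 0 \<longleftrightarrow> norm x powr \<alpha> < R powr \<alpha>"
      using assms by (simp add: wt_def powr_minus field_simps)
    also have "\<dots> \<longleftrightarrow> norm x < R"
      using powr_less_mono2[of \<alpha> "norm x" R] powr_mono2[of \<alpha> R "norm x"] \<alpha>_pos assms
      by (cases "norm x < R") auto
    finally show ?thesis .
  qed
  show ?thesis unfolding dom_def ball_def wt_pos dist_0_norm ..
qed

text \<open>Since 1 - q = -\<alpha>, both sides are 1 - (|x| / R)^\<alpha>.\<close>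

lemma q_log_eq_wt:
  assumes "R > 0" "x \<noteq> 0"
  shows "((1 + \<alpha>) - 1) * q_log (1 + \<alpha>) (R / norm x) = wt (- (R powr (- \<alpha>))) x"
  using assms \<alpha>_pos by (simp add: q_log_def wt_def powr_divide powr_minus field_simps)

lemma fun_integrand_eq:
  fixes u :: "real^'n \<Rightarrow> real"
  assumes "real CARD('n) / pstar = a"
  shows "fun_integrand pstar \<sigma> u = Fint 0 u"
proof -
  have "real CARD('n) * \<sigma> / pstar = a * \<sigma>" using assms by auto
  then show ?thesis by (simp add: fun_eq_iff fun_integrand_def Fint_def)
qed

lemma log_integrand_eq:
  fixes u :: "real^'n \<Rightarrow> real"
  assumes "real CARD('n) / pstar = a" "R > 0"
  shows "log_integrand pstar (1 + \<alpha>) R \<sigma> (1 + (\<theta> - 1) / \<theta> * \<sigma>) u = Fint (- (R powr (- \<alpha>))) u"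
proof
  fix x
  have "real CARD('n) * \<sigma> / pstar = a * \<sigma>" using assms(1) by auto
  then show "log_integrand pstar (1 + \<alpha>) R \<sigma> (1 + (\<theta> - 1) / \<theta> * \<sigma>) u x = Fint (- (R powr (- \<alpha>))) u x"
    using q_log_eq_wt[OF assms(2), of x]
    by (cases "x = 0") (simp_all add: log_integrand_def Fint_def)
qed

lemma field_integrand_eq:
  fixes V :: "real^'n \<Rightarrow> real^'n"
  assumes "real CARD('n) / p = a + 1" "\<And>x. x \<noteq> 0 \<Longrightarrow> V x = field c u x"
  shows "field_integrand p \<theta> V = Gint c u"
proof
  fix x
  have "real CARD('n) * \<theta> / p = (a + 1) * \<theta>" by (simp add: assms(1)[symmetric])
  then show "field_integrand p \<theta> V x = Gint c u x"
    using assms(2)[of x] by (cases "x = 0") (simp_all add: field_integrand_def Gint_def)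
qed

end

theorem theorem1p3:
  fixes p pstar \<theta> \<sigma> q R S St :: real
  assumes "1 < p" and "p < real CARD('n::finite)"
    and "\<theta> > 1" and "\<sigma> > 0"
    and "0 \<le> 1 / \<theta> - 1 / \<sigma>" and "1 / \<theta> - 1 / \<sigma> \<le> 1 / real CARD('n)"
    and "1 / pstar = 1 / p - 1 / real CARD('n)"
    and "q = 1 + (real CARD('n) - p) / p * (\<theta> / (\<theta> - 1))"
    and "R > 0"
    and "S = best_constant (C0_inf (UNIV :: (real^'n) set)) (CKN_lhs pstar \<sigma>) (CKN_rhs p \<theta>)"
    and "St = best_constant (C0_inf (UNIV :: (real^'n) set)) (radial_lhs pstar \<theta>) (radial_rhs p \<theta>)"
  shows
    "(\<forall>u \<in> C0_inf (ball (0 :: real^'n) R).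
        A_finite p pstar q R \<theta> \<sigma> u \<and> S * A_lhs pstar q R \<theta> \<sigma> u \<le> A_rhs p q R \<theta> u)
   \<and> (\<forall>C. (\<forall>u \<in> C0_inf (ball (0 :: real^'n) R).
              C * A_lhs pstar q R \<theta> \<sigma> u \<le> A_rhs p q R \<theta> u) \<longrightarrow> C \<le> S)
   \<and> (\<forall>u \<in> C0_inf (ball (0 :: real^'n) R). \<forall>l>0.
        A_finite p pstar q R \<theta> \<sigma> (scaled_fun p \<theta> R l u) \<and>
        A_lhs pstar q R \<theta> \<sigma> (scaled_fun p \<theta> R l u) = A_lhs pstar q R \<theta> \<sigma> u \<and>
        A_rhs p q R \<theta> (scaled_fun p \<theta> R l u) = A_rhs p q R \<theta> u)
   \<and> (\<theta> = \<sigma> \<longrightarrow>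
        (\<forall>u \<in> C0_inf (ball (0 :: real^'n) R).
           B_finite p pstar q R \<theta> u \<and> St * B_lhs pstar q R \<theta> u \<le> B_rhs p R \<theta> u)
      \<and> (\<forall>C. (\<forall>u \<in> C0_inf (ball (0 :: real^'n) R).
                 C * B_lhs pstar q R \<theta> u \<le> B_rhs p R \<theta> u) \<longrightarrow> C \<le> St)
      \<and> (\<forall>u \<in> C0_inf (ball (0 :: real^'n) R). \<forall>l>0.
           B_finite p pstar q R \<theta> (scaled_fun p \<theta> R l u) \<and>
           B_lhs pstar q R \<theta> (scaled_fun p \<theta> R l u) = B_lhs pstar q R \<theta> u \<and>
           B_rhs p R \<theta> (scaled_fun p \<theta> R l u) = B_rhs p R \<theta> u))"
proof -
  define N where "N = real CARD('n)"
  define a where "a = (N - p) / p"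
  have N: "N > 0" "p < N" using assms(1,2) by (simp_all add: N_def)
  have a_pos: "a > 0" using assms(1) N by (simp add: a_def)
  have Np: "real CARD('n) / p = a + 1" using assms(1) by (simp add: a_def N_def field_simps)
  have "N / pstar = N * (1 / p - 1 / N)" using assms(7) by (simp add: N_def divide_inverse)
  also have "\<dots> = a" using N assms(1) by (simp add: a_def field_simps)
  finally have Npstar: "real CARD('n) / pstar = a" by (simp add: N_def)
  \<comment> \<open>The two instances differ only in \<open>\<delta>\<close>, which enters the field
    alone. The exponent \<open>\<alpha>\<close>, the weights, domains and radial maps are common to
    both, so facts about them pass freely from \<open>A\<close> to \<open>B\<close>.\<close>
  interpret A: ckn a \<theta> \<sigma> 1 using a_pos assms(3,4) by unfold_locales
  interpret B: ckn a \<theta> \<sigma> 0 using a_pos assms(3,4) by unfold_locales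
  have \<alpha>: "A.\<alpha> = (real CARD('n) - p) / p * (\<theta> / (\<theta> - 1))"
    unfolding A.\<alpha>_def unfolding a_def N_def by simp
  have q: "q = 1 + A.\<alpha>" unfolding assms(8) \<alpha> ..
  have inv\<alpha>: "1 / A.\<alpha> = p / (real CARD('n) - p) * ((\<theta> - 1) / \<theta>)"
    unfolding \<alpha> by simp
  define c where "c = - (R powr (- A.\<alpha>))"
  have c: "c \<le> 0" by (simp add: c_def)
  have dom: "A.dom c = ball (0 :: real^'n) R" "B.dom c = ball (0 :: real^'n) R"
    unfolding c_def by (rule A.dom_eq_ball[OF assms(9)] B.dom_eq_ball[OF assms(9)])+
  \<comment> \<open>For \<open>\<delta>\<close> = 1 and c = 0 the weight is 1, and tangential and
    radial parts add up to the full gradient. For \<open>\<delta>\<close> = 0 the weight drops out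
    of the field, hence the arbitrary \<open>c'\<close>.\<close>
  have gA: "grad u x = A.field 0 u x" and LA: "x \<noteq> 0 \<Longrightarrow> L_op q R u x = A.field c u x"
    and gB: "grad_r u x = B.field c' u x" for u :: "real^'n \<Rightarrow> real" and x c'
    using A.q_log_eq_wt[OF assms(9), of x]
    by (simp_all add: A.field_def B.field_def grad_S_def L_op_def q c_def divide_inverse)
  have scaled: "scaled_fun p \<theta> R l u =
      (\<lambda>x. l powr (- ((\<theta> - 1) / \<theta>)) * u (A.radial_map l ((1 - l) * (- c)) x))" for l and u :: "real^'n \<Rightarrow> real"
    unfolding scaled_fun_def[abs_def] scaled_point_def A.radial_map_def c_def inv\<alpha> \<alpha> by simp

  have CKN: "CKN_lhs pstar \<sigma> = (\<lambda>u :: real^'n \<Rightarrow> real. A.F 0 u powr (1 / \<sigma>))"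
      "CKN_rhs p \<theta> = (\<lambda>u :: real^'n \<Rightarrow> real. A.G 0 u powr (1 / \<theta>))"
    unfolding CKN_lhs_def[abs_def] CKN_rhs_def[abs_def] A.fun_integrand_eq[OF Npstar]
      A.field_integrand_eq[OF Np gA] A.F_def[abs_def] A.G_def[abs_def] A.dom_0 set_lebesgue_integral_def by simp_all
  have intA: "A_integrand_lhs pstar q R \<theta> \<sigma> u = A.Fint c u" "A_integrand_rhs p q R \<theta> u = A.Gint c u"
    for u :: "real^'n \<Rightarrow> real"
    unfolding A_integrand_lhs_def A_integrand_rhs_def q c_def
    using A.log_integrand_eq[OF Npstar assms(9)] A.field_integrand_eq[OF Np LA, unfolded q c_def] by blast+
  have A: "A_lhs pstar q R \<theta> \<sigma> u = A.F c u powr (1 / \<sigma>)" "A_rhs p q R \<theta> u = A.G c u powr (1 / \<theta>)"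
    "A_finite p pstar q R \<theta> \<sigma> u \<longleftrightarrow>
      set_integrable lborel (A.dom c) (A.Fint c u) \<and> set_integrable lborel (A.dom c) (A.Gint c u)"
    for u :: "real^'n \<Rightarrow> real"
    unfolding A_lhs_def A_rhs_def A_finite_def intA A.F_def A.G_def dom by (rule refl)+
  have S: "(\<forall>u \<in> C0_inf (ball (0 :: real^'n) R). C * A_lhs pstar q R \<theta> \<sigma> u \<le> A_rhs p q R \<theta> u) \<longleftrightarrow> C \<le> S" for C
    unfolding A assms(10) CKN dom(1)[symmetric] using assms(3,4) by (intro A.sharp_constant c) auto
  have partA: "A_finite p pstar q R \<theta> \<sigma> u"
    "l > 0 \<Longrightarrow> A_finite p pstar q R \<theta> \<sigma> (scaled_fun p \<theta> R l u)"
    "l > 0 \<Longrightarrow> A_lhs pstar q R \<theta> \<sigma> (scaled_fun p \<theta> R l u) = A_lhs pstar q R \<theta> \<sigma> u"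
    "l > 0 \<Longrightarrow> A_rhs p q R \<theta> (scaled_fun p \<theta> R l u) = A_rhs p q R \<theta> u"
    if "u \<in> C0_inf (ball (0 :: real^'n) R)" for u l
    using that A.integrable_F_G[of u c] A.scaling_invariance[OF c, of l u]
    unfolding A scaled dom by simp_all

  \<comment> \<open>The exponent 1 is written out to bring (B) and the radial inequality into the
    form required by \<open>sharp_constant\<close>.\<close>
  have B: "B_lhs pstar q R \<theta> u = B.F c u powr 1" "B_rhs p R \<theta> u = B.G c u powr 1"
    "radial_lhs pstar \<theta> u = B.F 0 u powr 1" "radial_rhs p \<theta> u = B.G 0 u powr 1"
    "B_finite p pstar q R \<theta> u \<longleftrightarrow>
      set_integrable lborel (B.dom c) (B.Fint c u) \<and> set_integrable lborel (B.dom c) (B.Gint c u)"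
    if "\<theta> = \<sigma>" for u :: "real^'n \<Rightarrow> real"
  proof -
    \<comment> \<open>This makes (B) a case of the same weighted functional: for \<theta> = \<sigma>
      the weight exponent of (A) becomes \<theta>.\<close>
    have e: "1 + (\<theta> - 1) / \<theta> * \<sigma> = \<theta>" using that assms(3) by simp
    have 1: "B_integrand_lhs pstar q R \<theta> u = B.Fint c u"
      using B.log_integrand_eq[OF Npstar assms(9), of u] that unfolding e B_integrand_lhs_def q c_def by simp
    have 2: "B_integrand_rhs p \<theta> u = B.Gint c u"
      unfolding B_integrand_rhs_def by (rule B.field_integrand_eq[OF Np gB])
    have 3: "fun_integrand pstar \<theta> u = B.Fint 0 u"
      using B.fun_integrand_eq[OF Npstar, of u] that by simp
    have 4: "field_integrand p \<theta> (grad_r u) = B.Gint 0 u"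
      by (rule B.field_integrand_eq[OF Np gB])
    show "B_lhs pstar q R \<theta> u = B.F c u powr 1" "B_rhs p R \<theta> u = B.G c u powr 1"
      "radial_lhs pstar \<theta> u = B.F 0 u powr 1" "radial_rhs p \<theta> u = B.G 0 u powr 1"
      unfolding powr_one[OF B.F_nonneg] powr_one[OF B.G_nonneg]
      unfolding B_lhs_def B_rhs_def radial_lhs_def radial_rhs_def
        1 2 3 4 B.F_def B.G_def dom B.dom_0 by (simp_all add: set_lebesgue_integral_def)
    show "B_finite p pstar q R \<theta> u \<longleftrightarrow>
        set_integrable lborel (B.dom c) (B.Fint c u) \<and> set_integrable lborel (B.dom c) (B.Gint c u)"
      unfolding B_finite_def 1 2 dom ..
  qed
  have St: "(\<forall>u \<in> C0_inf (ball (0 :: real^'n) R). C * B_lhs pstar q R \<theta> u \<le> B_rhs p R \<theta> u) \<longleftrightarrow> C \<le> St"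
    if "\<theta> = \<sigma>" for C
  proof -
    have r: "radial_lhs pstar \<theta> = (\<lambda>u :: real^'n \<Rightarrow> real. B.F 0 u powr 1)"
      "radial_rhs p \<theta> = (\<lambda>u :: real^'n \<Rightarrow> real. B.G 0 u powr 1)"
      using B(3,4)[OF that] by (simp_all add: fun_eq_iff)
    show ?thesis
      unfolding B(1,2)[OF that] assms(11) r dom(2)[symmetric] by (rule B.sharp_constant[OF c zero_less_one zero_less_one])
  qed
  have partB: "B_finite p pstar q R \<theta> u"
    "l > 0 \<Longrightarrow> B_finite p pstar q R \<theta> (scaled_fun p \<theta> R l u)"
    "l > 0 \<Longrightarrow> B_lhs pstar q R \<theta> (scaled_fun p \<theta> R l u) = B_lhs pstar q R \<theta> u"
    "l > 0 \<Longrightarrow> B_rhs p R \<theta> (scaled_fun p \<theta> R l u) = B_rhs p R \<theta> u"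
    if "\<theta> = \<sigma>" "u \<in> C0_inf (ball (0 :: real^'n) R)" for u l
    using that(2) B.integrable_F_G[of u c] B.scaling_invariance[OF c, of l u]
    unfolding B[OF that(1)] scaled dom by simp_all

  show ?thesis
  proof (intro conjI impI allI ballI)
    fix u assume "u \<in> C0_inf (ball (0 :: real^'n) R)"
    then show "S * A_lhs pstar q R \<theta> \<sigma> u \<le> A_rhs p q R \<theta> u" using S[of S] by simp
  next
    fix u assume "\<theta> = \<sigma>" "u \<in> C0_inf (ball (0 :: real^'n) R)"
    then show "St * B_lhs pstar q R \<theta> u \<le> B_rhs p R \<theta> u" using St[of St] by simp
  next
    fix C assume "\<forall>u \<in> C0_inf (ball (0 :: real^'n) R). C * A_lhs pstar q R \<theta> \<sigma> u \<le> A_rhs p q R \<theta> u"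
    then show "C \<le> S" using S by simp
  next
    fix C assume "\<theta> = \<sigma>" "\<forall>u \<in> C0_inf (ball (0 :: real^'n) R). C * B_lhs pstar q R \<theta> u \<le> B_rhs p R \<theta> u"
    then show "C \<le> St" using St by simp
  qed (use partA partB in auto)
qed

end
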